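(* Let $\psi\in C^2(\mathbb{R})$ satisfy $\psi''(x)>0$ for all $x\in\mathbb{R}$, and let $\Gamma=\{(x,\psi(x)):x\in[-1,1]\}\subset\mathbb{R}^2$. Let $s\in[2/3,1]$. For every $\epsilon\in(0,1)$ there is a constant $C(\psi,s,\epsilon)$ such that for every $(s,1)$-Frostman measure $\sigma$ on $\Gamma$, $$ \|\widehat{\sigma}\|_{L^6(B(R))}^6\le C(\psi,s,\epsilon)\,R^{1-s+\epsilon},\qquad R\ge 1. $$
   Context: A Borel measure $\sigma$ on $\mathbb{R}^2$ is an $(s,1)$-Frostman measure if $\sigma(B(x,r))\le r^s$ for all $x\in\mathbb{R}^2$ and $r>0$; "on $\Gamma$" means supported on $\Gamma$. $\widehat{\sigma}(\xi)=\int e^{-2\pi i x\cdot\xi}\,d\sigma(x)$, and $B(R)$ is the ball of radius $R$ centred at the origin in $\mathbb{R}^2$. *)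

theory Defs
  imports "HOL-Analysis.Analysis"
begin

definition C2 :: "(real \<Rightarrow> real) \<Rightarrow> bool" where
  "C2 f \<longleftrightarrow> f differentiable_on UNIV \<and> deriv f differentiable_on UNIV
     \<and> continuous_on UNIV (deriv (deriv f))"

definition curve :: "(real \<Rightarrow> real) \<Rightarrow> (real \<times> real) set" where
  "curve \<psi> = {(x, \<psi> x) | x. x \<in> {-1..1}}"

text \<open>The plane is \<^typ>\<open>real \<times> real\<close>, whose distance and inner product are the Euclidean ones.
  Because the radius ranges over all positive reals, open and closed balls give the same condition.
  Finiteness of the measure is not assumed.\<close>

definition frostman :: "real \<Rightarrow> (real \<times> real) measure \<Rightarrow> bool" where
  "frostman s \<sigma> \<longleftrightarrow> sets \<sigma> = sets borel
     \<and> (\<forall>x r. r > 0 \<longrightarrow> emeasure \<sigma> (ball x r) \<le> ennreal (r powr s))"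

definition measure_support :: "'a::topological_space measure \<Rightarrow> 'a set" where
  "measure_support \<sigma> = {x. \<forall>U. open U \<and> x \<in> U \<longrightarrow> emeasure \<sigma> U > 0}"

definition fourier_measure :: "'a::euclidean_space measure \<Rightarrow> 'a \<Rightarrow> complex" where
  "fourier_measure \<sigma> \<xi> = (\<integral>x. exp (- 2 * of_real pi * \<i> * of_real (x \<bullet> \<xi>)) \<partial>\<sigma>)"

end

theory Submission
  imports Defs "HOL-Probability.Convolution" "HOL-Probability.Characteristic_Functions"
begin

text \<open>
  Up to a Gaussian cut-off, the sixth moment of the Fourier transform \<open>F\<close> of \<open>\<sigma>\<close> over \<open>B(R)\<close> is \<open>R\<^sup>2\<close>
  times the mass of the six-fold sums \<open>x\<^sub>1 + x\<^sub>2 + x\<^sub>3 - x\<^sub>4 - x\<^sub>5 - x\<^sub>6\<close> within distance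
  \<open>1 / R\<close> of the origin, all points being distributed by \<open>\<sigma>\<close> (lemma \<open>fourier_gauss_measure\<close>). At this
  scale the Frostman condition says that \<open>\<sigma>\<close> is at most \<open>R\<^sup>1\<^sup>-\<^sup>s\<close> times the uniform measure \<open>\<gamma>\<close> on the
  curve (\<open>gaussian_domination\<close>). The idea is to use this for only one of the six points. Returning
  to the frequency side, this bounds the sixth moment by \<open>R\<^sup>1\<^sup>-\<^sup>s\<close> times the integral of \<open>\<bar>F\<bar>\<^sup>5 \<bar>G\<bar>\<close>,
  where \<open>G\<close> is the Fourier transform of \<open>\<gamma>\<close> (\<open>moment_6_le_mixed\<close>).

  The factor \<open>R\<^sup>1\<^sup>-\<^sup>s\<close> is the claimed bound, so the remaining integral must be at most logarithmic.
  The curvature enters twice. First, \<open>\<bar>G \<xi>\<bar>\<close> is at most a constant times \<open>\<bar>\<xi>\<bar>\<^sup>-\<^sup>1\<^sup>/\<^sup>2\<close>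
  (\<open>fourier_graph_decay\<close>). Secondly, an approximate solution of \<open>a + b = c + d\<close> on the curve is nearly
  diagonal (\<open>four_points_on_graph\<close>), which makes the fourth moment at most \<open>R\<^sup>2\<^sup>-\<^sup>2\<^sup>s\<close> up to logarithms
  (\<open>moment_4_le\<close>). On a dyadic annulus \<open>\<bar>\<xi>\<bar> \<approx> r\<close>, Cauchy--Schwarz bounds the integral of
  \<open>\<bar>F\<bar>\<^sup>5 \<bar>G\<bar>\<close> by \<open>r\<^sup>-\<^sup>1\<^sup>/\<^sup>2\<close> times the square roots of the fourth and of the sixth moment at scale \<open>r\<close>. If the
  latter is \<open>f(r) r\<^sup>1\<^sup>-\<^sup>s\<close>, the result is \<open>r\<^sup>1\<^sup>-\<^sup>3\<^sup>s\<^sup>/\<^sup>2 sqrt (f(r))\<close> up to logarithms. For \<open>s \<ge> 2/3\<close> the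
  power of \<open>r\<close> is harmless. Summing over the logarithmically many dyadic \<open>r \<le> R\<close> gives
  \<open>f(R) \<le> polylog(R) sup\<^sub>r sqrt (f(r))\<close>, and an inequality of this form forces \<open>f\<close> itself to
  grow at most like a power of \<open>log R\<close> (\<open>sqrt_recursion_bound\<close>, \<open>moment_6_le\<close>), which is
  less than \<open>R\<^sup>\<epsilon>\<close>.
\<close>

section \<open>Gaussian averages of Fourier transforms of measures\<close>

text \<open>With \<open>R\<close> replaced by \<open>1 / R\<close> this is the frequency weight that localises to \<open>B(R)\<close>;
  with \<open>R\<close> itself it is, up to the factor \<open>R\<^sup>2\<close>, the Fourier transform of that weight, which
  localises to distance \<open>1 / R\<close> from the origin.\<close>
definition gauss :: "real \<Rightarrow> real \<times> real \<Rightarrow> real" where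
  "gauss R x = exp (- pi * (R * norm x)\<^sup>2)"

lemma gauss_measurable [measurable]: "gauss R \<in> borel_measurable borel"
  unfolding gauss_def by measurable

lemma gauss_pos: "0 < gauss R x" and gauss_le_1: "gauss R x \<le> 1"
  by (auto simp: gauss_def)

text \<open>A linear substitution turns this into the characteristic function of the standard normal
  distribution.\<close>
lemma fourier_gaussian_real:
  fixes R x :: real
  assumes "R > 0"
  shows "(\<integral>t. complex_of_real (exp (- pi * (t / R)\<^sup>2)) * exp (- 2 * of_real pi * \<i> * of_real (x * t)) \<partial>lborel)
     = of_real (R * exp (- pi * (R * x)\<^sup>2))" (is "?I = _")
proof -
  define u where "u = - x * sqrt (2 * pi) * R"
  define c where "c = sqrt (2 * pi) / R"
  have c: "c > 0" using assms by (simp add: c_def)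
  have uc: "u * c = - 2 * pi * x" using assms by (simp add: u_def c_def)
  have cc: "c\<^sup>2 = 2 * pi / R\<^sup>2" using assms by (simp add: c_def power_divide)
  have "of_real (exp (- (u\<^sup>2) / 2)) = char std_normal_distribution u"
    by (simp add: char_std_normal_distribution)
  also have "\<dots> = (\<integral>y. std_normal_density y *\<^sub>R iexp (u * y) \<partial>lborel)"
    unfolding char_def by (subst integral_density) auto
  also have "\<dots> = \<bar>c\<bar> *\<^sub>R (\<integral>t. std_normal_density (0 + c * t) *\<^sub>R iexp (u * (0 + c * t)) \<partial>lborel)"
    using c by (intro lborel_integral_real_affine) auto
  also have "(\<lambda>t. std_normal_density (0 + c * t) *\<^sub>R iexp (u * (0 + c * t))) = (\<lambda>t. of_real (1 / sqrt (2 * pi)) *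
     (complex_of_real (exp (- pi * (t / R)\<^sup>2)) * exp (- 2 * of_real pi * \<i> * of_real (x * t))))"
  proof
    fix t
    have 1: "- (c * t)\<^sup>2 / 2 = - pi * (t / R)\<^sup>2"
      by (simp add: power_mult_distrib cc power_divide)
    have 2: "u * (c * t) = - 2 * pi * x * t" using uc by (metis mult.assoc)
    show "std_normal_density (0 + c * t) *\<^sub>R iexp (u * (0 + c * t)) = of_real (1 / sqrt (2 * pi)) *
     (complex_of_real (exp (- pi * (t / R)\<^sup>2)) * exp (- 2 * of_real pi * \<i> * of_real (x * t)))"
      unfolding std_normal_density_def add_0 1 2 by (simp add: scaleR_conv_of_real mult_ac)
  qed
  also have "\<bar>c\<bar> *\<^sub>R (\<integral>t. of_real (1 / sqrt (2 * pi)) *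
     (complex_of_real (exp (- pi * (t / R)\<^sup>2)) * exp (- 2 * of_real pi * \<i> * of_real (x * t))) \<partial>lborel)
     = of_real (1 / R) * ?I"
    using c assms by (subst integral_mult_right_zero) (simp add: scaleR_conv_of_real c_def)
  finally have "of_real (exp (- (u\<^sup>2) / 2)) = of_real (1 / R) * ?I" .
  moreover have "- (u\<^sup>2) / 2 = - pi * (R * x)\<^sup>2" by (simp add: u_def power_mult_distrib)
  ultimately show ?thesis using assms by (simp add: field_simps)
qed

lemma integrable_gaussian_real:
  assumes "R > 0"
  shows "integrable lborel (\<lambda>t::real. exp (- pi * (t / R)\<^sup>2))"
proof -
  have "integrable lborel (\<lambda>t. sqrt (2*pi) * std_normal_density (0 + (sqrt (2 * pi) / R) * t))"
    using assms integrable_normal_density[of 1 0]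
    by (intro integrable_mult_right lborel_integrable_real_affine) auto
  also have "(\<lambda>t. sqrt (2*pi) * std_normal_density (0 + (sqrt (2 * pi) / R) * t)) = (\<lambda>t::real. exp (- pi * (t / R)\<^sup>2))"
    by (auto simp: std_normal_density_def fun_eq_iff power_mult_distrib power_divide)
  finally show ?thesis .
qed

lemma gauss_Pair:
  "gauss (1 / R) (a, b) = exp (- pi * (a / R)\<^sup>2) * exp (- pi * (b / R)\<^sup>2)"
  "gauss R (a, b) = exp (- pi * (R * a)\<^sup>2) * exp (- pi * (R * b)\<^sup>2)"
  by (auto simp: gauss_def norm_Pair power_mult_distrib power_divide real_sqrt_pow2
      simp flip: exp_add, auto simp: field_simps add_divide_distrib)

lemma integrable_gauss:
  assumes "R > 0"
  shows "integrable lborel (gauss (1 / R))"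
proof -
  have *: "integrable (lborel \<Otimes>\<^sub>M lborel) (\<lambda>(a,b). exp (- pi * (a / R)\<^sup>2) * exp (- pi * (b / R)\<^sup>2))"
    by (rule lborel_pair.Fubini_integrable)
       (use integrable_gaussian_real[OF assms] in \<open>simp_all add: abs_mult\<close>)
  have "gauss (1 / R) = (\<lambda>(a,b). exp (- pi * (a / R)\<^sup>2) * exp (- pi * (b / R)\<^sup>2))"
    by (intro ext) (simp only: case_prod_beta gauss_Pair(1)[symmetric] prod.collapse)
  with * show ?thesis by (simp only: lborel_prod)
qed

lemma fourier_gauss:
  fixes x :: "real \<times> real"
  assumes "R > 0"
  shows "(\<integral>\<xi>. of_real (gauss (1 / R) \<xi>) * exp (- 2 * of_real pi * \<i> * of_real (x \<bullet> \<xi>)) \<partial>lborel)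
     = of_real (R\<^sup>2 * gauss R x)"
proof -
  obtain p q where x: "x = (p, q)" by force
  define f where "f r t = complex_of_real (exp (- pi * (t / R)\<^sup>2)) * exp (- 2 * of_real pi * \<i> * of_real (r * t))" for r t
  have f [measurable]: "f r \<in> borel_measurable borel" for r unfolding f_def by measurable
  have nf: "norm (f r t) = exp (- pi * (t / R)\<^sup>2)" for r t by (simp add: f_def norm_mult)
  have fi: "integrable lborel (f r)" for r
    by (rule Bochner_Integration.integrable_bound[OF integrable_gaussian_real[OF assms]]) (auto simp: nf)
  have *: "integrable (lborel \<Otimes>\<^sub>M lborel) (\<lambda>(a,b). f p a * f q b)"
    by (rule lborel_pair.Fubini_integrable)
       (use integrable_gaussian_real[OF assms] fi in \<open>simp_all add: norm_mult nf\<close>)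
  have "of_real (gauss (1 / R) \<xi>) * exp (- 2 * of_real pi * \<i> * of_real (x \<bullet> \<xi>)) = (case \<xi> of (a, b) \<Rightarrow> f p a * f q b)" for \<xi>
  proof (cases \<xi>)
    case (Pair a b)
    have "exp (- 2 * of_real pi * \<i> * of_real (x \<bullet> \<xi>))
       = exp (- 2 * of_real pi * \<i> * of_real (p * a)) * exp (- 2 * of_real pi * \<i> * of_real (q * b))"
      by (simp add: x Pair exp_add[symmetric] algebra_simps)
    thus ?thesis by (simp add: Pair f_def gauss_Pair)
  qed
  hence "(\<integral>\<xi>. of_real (gauss (1 / R) \<xi>) * exp (- 2 * of_real pi * \<i> * of_real (x \<bullet> \<xi>)) \<partial>lborel)
     = (\<integral>\<xi>. (case \<xi> of (a, b) \<Rightarrow> f p a * f q b) \<partial>lborel)" by presburger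
  also have "\<dots> = (\<integral>\<xi>. (case \<xi> of (a, b) \<Rightarrow> f p a * f q b) \<partial>(lborel \<Otimes>\<^sub>M lborel))"
    by (simp add: lborel_prod)
  also have "\<dots> = (\<integral>a. \<integral>b. f p a * f q b \<partial>lborel \<partial>lborel)"
    using lborel_pair.integral_fst'[OF *] by simp
  also have "\<dots> = (\<integral>a. f p a \<partial>lborel) * (\<integral>b. f q b \<partial>lborel)" by simp
  also have "\<dots> = of_real (R * exp (- pi * (R * p)\<^sup>2)) * of_real (R * exp (- pi * (R * q)\<^sup>2))"
    unfolding f_def fourier_gaussian_real[OF assms] ..
  also have "\<dots> = of_real (R\<^sup>2 * gauss R x)" by (simp add: x gauss_Pair power2_eq_square)
  finally show ?thesis .
qed

lemma norm_character [simp]: "norm (exp (- 2 * of_real pi * \<i> * of_real t)) = 1" for t :: real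
  by (simp)

lemma integrable_character:
  fixes \<mu> :: "'a::euclidean_space measure"
  assumes "finite_measure \<mu>" "sets \<mu> = sets borel"
  shows "integrable \<mu> (\<lambda>x. exp (- 2 * of_real pi * \<i> * of_real (x \<bullet> \<xi>)))"
proof -
  interpret finite_measure \<mu> by fact
  show ?thesis using assms(2)
    by (intro integrable_const_bound[where B = 1]) (auto cong: measurable_cong_sets)
qed

lemma measurable_fourier_measure [measurable]:
  fixes \<mu> :: "'a::euclidean_space measure"
  assumes "finite_measure \<mu>" and [measurable_cong]: "sets \<mu> = sets borel"
  shows "fourier_measure \<mu> \<in> borel_measurable borel"
proof -
  interpret finite_measure \<mu> by fact
  show ?thesis unfolding fourier_measure_def[abs_def] by measurable
qed

lemma norm_fourier_measure_le:
  fixes \<mu> :: "'a::euclidean_space measure"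
  assumes "finite_measure \<mu>" "sets \<mu> = sets borel"
  shows "norm (fourier_measure \<mu> \<xi>) \<le> measure \<mu> UNIV"
proof -
  interpret finite_measure \<mu> by fact
  have "space \<mu> = UNIV" using sets_eq_imp_space_eq[OF assms(2)] by simp
  thus ?thesis unfolding fourier_measure_def
    using integral_norm_bound[of \<mu> "\<lambda>x. exp (- 2 * of_real pi * \<i> * of_real (x \<bullet> \<xi>))"] by simp
qed

text \<open>Fubini moves the Gaussian weight onto the characters. Thus weighted frequency integrals are
  turned into masses near the origin, where the geometry of the measure can be used.\<close>
lemma fourier_gauss_measure:
  assumes "R > 0" and fin: "finite_measure \<mu>" and sets [measurable_cong]: "sets \<mu> = sets borel"
  shows "(\<integral>\<xi>. of_real (gauss (1 / R) \<xi>) * fourier_measure \<mu> \<xi> \<partial>lborel) = of_real (R\<^sup>2 * (\<integral>x. gauss R x \<partial>\<mu>))"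
proof -
  interpret finite_measure \<mu> by fact
  interpret P: pair_sigma_finite "lborel :: (real \<times> real) measure" \<mu> ..
  define f where "f \<xi> x = complex_of_real (gauss (1 / R) \<xi>) * exp (- 2 * of_real pi * \<i> * of_real (x \<bullet> \<xi>))" for \<xi> x :: "real \<times> real"
  have [measurable]: "(\<lambda>(\<xi>, x). f \<xi> x) \<in> borel_measurable (lborel \<Otimes>\<^sub>M \<mu>)"
    unfolding f_def by measurable
  have nf: "norm (f \<xi> x) = gauss (1 / R) \<xi>" for \<xi> x
    by (simp add: f_def norm_mult gauss_pos less_imp_le)
  have I: "integrable (lborel \<Otimes>\<^sub>M \<mu>) (\<lambda>(\<xi>, x). f \<xi> x)"
  proof (rule P.Fubini_integrable)
    show "integrable lborel (\<lambda>x. \<integral>y. norm (case (x, y) of (x, xa) \<Rightarrow> f x xa) \<partial>\<mu>)"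
      using integrable_gauss[OF assms(1)] by (simp add: nf)
    show "AE x in lborel. integrable \<mu> (\<lambda>y. case (x, y) of (x, xa) \<Rightarrow> f x xa)"
      unfolding f_def using integrable_character[OF fin sets] by auto
  qed simp
  have "(\<integral>\<xi>. of_real (gauss (1 / R) \<xi>) * fourier_measure \<mu> \<xi> \<partial>lborel) = (\<integral>\<xi>. \<integral>x. f \<xi> x \<partial>\<mu> \<partial>lborel)"
    unfolding f_def fourier_measure_def by simp
  also have "\<dots> = (\<integral>x. \<integral>\<xi>. f \<xi> x \<partial>lborel \<partial>\<mu>)"
    by (rule P.Fubini_integral[symmetric]) (use I in simp)
  also have "\<dots> = (\<integral>x. of_real (R\<^sup>2 * gauss R x) \<partial>\<mu>)"
    unfolding f_def fourier_gauss[OF assms(1)] ..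
  also have "\<dots> = of_real (R\<^sup>2 * (\<integral>x. gauss R x \<partial>\<mu>))"
    by (simp only: integral_complex_of_real) simp
  finally show ?thesis .
qed

lemma fourier_measure_convolution:
  fixes \<mu> \<nu> :: "'a::ordered_euclidean_space measure"
  assumes "finite_measure \<mu>" "finite_measure \<nu>"
    and [measurable_cong]: "sets \<mu> = sets borel" "sets \<nu> = sets borel"
  shows "fourier_measure (\<mu> \<star> \<nu>) \<xi> = fourier_measure \<mu> \<xi> * fourier_measure \<nu> \<xi>"
proof -
  interpret M: finite_measure \<mu> by fact
  interpret N: finite_measure \<nu> by fact
  interpret P: pair_sigma_finite \<mu> \<nu> ..
  interpret PF: finite_measure "\<mu> \<Otimes>\<^sub>M \<nu>"
    by (intro finite_measure_pair_measure assms)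
  define e where "e x = exp (- 2 * of_real pi * \<i> * of_real (x \<bullet> \<xi>))" for x
  have [measurable]: "e \<in> borel_measurable borel" unfolding e_def by measurable
  have ee: "e (x + y) = e x * e y" for x y
    by (simp add: e_def inner_add_left algebra_simps exp_add[symmetric])
  have I: "integrable (\<mu> \<Otimes>\<^sub>M \<nu>) (\<lambda>(x, y). e x * e y)"
    by (intro PF.integrable_const_bound[where B = 1]) (auto simp: norm_mult e_def)
  have "fourier_measure (\<mu> \<star> \<nu>) \<xi> = (\<integral>z. e ((\<lambda>(x, y). x + y) z) \<partial>(\<mu> \<Otimes>\<^sub>M \<nu>))"
    unfolding fourier_measure_def convolution_def e_def[symmetric]
    by (rule integral_distr) auto
  also have "\<dots> = (\<integral>z. (case z of (x, y) \<Rightarrow> e x * e y) \<partial>(\<mu> \<Otimes>\<^sub>M \<nu>))"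
    by (intro Bochner_Integration.integral_cong) (auto simp: ee)
  also have "\<dots> = (\<integral>x. \<integral>y. e x * e y \<partial>\<nu> \<partial>\<mu>)"
    using P.integral_fst'[OF I] by simp
  also have "\<dots> = fourier_measure \<mu> \<xi> * fourier_measure \<nu> \<xi>"
    by (simp add: fourier_measure_def e_def)
  finally show ?thesis .
qed

definition reflection :: "'a::euclidean_space measure \<Rightarrow> 'a measure" where
  "reflection \<mu> = distr \<mu> borel uminus"

lemma sets_reflection [simp]: "sets (reflection \<mu>) = sets borel"
  by (simp add: reflection_def)

lemma finite_measure_reflection:
  assumes "finite_measure \<mu>" and [measurable_cong]: "sets \<mu> = sets borel"
  shows "finite_measure (reflection \<mu>)"
  unfolding reflection_def using assms(1) by (intro finite_measure.finite_measure_distr) auto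

lemma fourier_measure_reflection:
  assumes [measurable_cong]: "sets \<mu> = sets borel"
  shows "fourier_measure (reflection \<mu>) \<xi> = cnj (fourier_measure \<mu> \<xi>)"
proof -
  have "fourier_measure (reflection \<mu>) \<xi> = (\<integral>x. exp (- 2 * of_real pi * \<i> * of_real (- x \<bullet> \<xi>)) \<partial>\<mu>)"
    unfolding fourier_measure_def reflection_def by (subst integral_distr) auto
  also have "\<dots> = (\<integral>x. cnj (exp (- 2 * of_real pi * \<i> * of_real (x \<bullet> \<xi>))) \<partial>\<mu>)"
    by (simp add: exp_cnj)
  finally show ?thesis by (simp add: fourier_measure_def)
qed

lemma nn_integral_reflection:
  assumes [measurable_cong]: "sets \<mu> = sets borel" and [measurable]: "f \<in> borel_measurable borel"
  shows "(\<integral>\<^sup>+x. f x \<partial>reflection \<mu>) = (\<integral>\<^sup>+x. f (- x) \<partial>\<mu>)"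
  unfolding reflection_def by (subst nn_integral_distr) auto

section \<open>Decay of the Fourier transform of the graph of a convex function\<close>

text \<open>A second derivative test of van der Corput type. Instead of splitting the interval at the
  stationary point, integrate the derivative of \<open>e\<^sup>i\<^sup>\<phi> \<phi>' / (\<phi>'\<^sup>2 + \<Lambda>)\<close>: it equals \<open>i e\<^sup>i\<^sup>\<phi>\<close> up to an error
  that is bounded by \<open>\<Lambda> / (\<phi>'\<^sup>2 + \<Lambda>) + \<phi>'' / (\<phi>'\<^sup>2 + \<Lambda>)\<close>, and the last term has the primitive
  \<open>arctan (\<phi>' / sqrt \<Lambda>) / sqrt \<Lambda>\<close>, whose variation is at most \<open>\<pi> / sqrt \<Lambda>\<close>. The alternative
  in the last hypothesis covers phases without a stationary point, where \<open>\<phi>'\<close> is so large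
  that already \<open>\<Lambda> / (\<phi>'\<^sup>2 + \<Lambda>)\<close> is at most \<open>1 / sqrt \<Lambda>\<close>.\<close>
lemma oscillatory_integral_bound:
  fixes \<phi> \<phi>1 \<phi>2 :: "real \<Rightarrow> real" and a b \<Lambda> :: real
  assumes ab: "a \<le> b" and \<Lambda>: "\<Lambda> > 0"
    and d1: "\<And>x. x \<in> {a..b} \<Longrightarrow> (\<phi> has_real_derivative \<phi>1 x) (at x)"
    and d2: "\<And>x. x \<in> {a..b} \<Longrightarrow> (\<phi>1 has_real_derivative \<phi>2 x) (at x)"
    and c2: "continuous_on {a..b} \<phi>2"
    and pos: "\<And>x. x \<in> {a..b} \<Longrightarrow> \<phi>2 x \<ge> 0"
    and big: "\<And>x. x \<in> {a..b} \<Longrightarrow> \<phi>2 x \<ge> \<Lambda> \<or> (\<phi>1 x)\<^sup>2 \<ge> \<Lambda> * sqrt \<Lambda>"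
  shows "norm (integral {a..b} (\<lambda>x. exp (\<i> * of_real (\<phi> x)))) \<le> (1 + 2 * pi + (b - a)) / sqrt \<Lambda>"
proof -
  define q where "q x = (\<phi>1 x)\<^sup>2 + \<Lambda>" for x
  define h where "h x = \<phi>1 x / q x" for x
  define e where "e x = exp (\<i> * complex_of_real (\<phi> x))" for x
  define k where "k x = \<phi>2 x * (\<Lambda> - (\<phi>1 x)\<^sup>2) / (q x)\<^sup>2" for x
  define g where "g x = e x * (\<i> * of_real (\<Lambda> / q x) - of_real (k x))" for x
  have q: "q x > 0" for x using \<Lambda> by (auto simp: q_def intro: add_nonneg_pos)
  have cphi: "continuous_on {a..b} \<phi>" "continuous_on {a..b} \<phi>1"
    using DERIV_continuous_on[of "{a..b}" \<phi> \<phi>1] DERIV_continuous_on[of "{a..b}" \<phi>1 \<phi>2]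
      has_field_derivative_at_within[OF d1] has_field_derivative_at_within[OF d2] by blast+
  have cq: "continuous_on {a..b} q" unfolding q_def by (intro continuous_intros cphi)
  have ce: "continuous_on {a..b} e" unfolding e_def by (intro continuous_intros cphi)
  have ck: "continuous_on {a..b} k" unfolding k_def
    by (intro continuous_intros cphi cq c2) (use q in \<open>auto simp: less_imp_neq[THEN not_sym]\<close>)
  have cg: "continuous_on {a..b} g" unfolding g_def
    by (intro continuous_intros ce ck cq) (use q in \<open>auto simp: less_imp_neq[THEN not_sym]\<close>)
  have h': "(h has_real_derivative k x) (at x)" if "x \<in> {a..b}" for x
    unfolding h_def q_def k_def using q[of x]
    by (auto intro!: derivative_eq_intros d2[OF that] simp: q_def field_simps power2_eq_square)
  have e': "(e has_vector_derivative \<i> * of_real (\<phi>1 x) * e x) (at x)" if "x \<in> {a..b}" for x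
  proof -
    have "((\<lambda>x. iexp (\<phi> x)) has_vector_derivative \<phi>1 x *\<^sub>R (\<i> * iexp (\<phi> x))) (at x)"
      using vector_diff_chain_at[of \<phi> "\<phi>1 x" x iexp "\<i> * iexp (\<phi> x)"] d1[OF that]
        has_vector_derivative_iexp[of "\<phi> x" UNIV]
      by (auto simp: has_real_derivative_iff_has_vector_derivative o_def)
    thus ?thesis unfolding e_def by (simp add: scaleR_conv_of_real mult_ac)
  qed
  have eh: "((\<lambda>x. e x * of_real (h x)) has_vector_derivative \<i> * e x - g x) (at x)" if x: "x \<in> {a..b}" for x
  proof -
    have "((\<lambda>x. complex_of_real (h x)) has_vector_derivative of_real (k x)) (at x)"
      using h'[OF x] by (intro has_vector_derivative_of_real)
        (auto simp: has_real_derivative_iff_has_vector_derivative)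
    from has_vector_derivative_mult[OF e'[OF x] this]
    have "((\<lambda>x. e x * of_real (h x)) has_vector_derivative
        e x * of_real (k x) + \<i> * of_real (\<phi>1 x) * e x * of_real (h x)) (at x)" .
    moreover have "\<phi>1 x * h x = 1 - \<Lambda> / q x"
      using q[of x] by (simp add: h_def field_simps) (simp add: q_def power2_eq_square)
    hence "complex_of_real (\<phi>1 x) * of_real (h x) = 1 - of_real (\<Lambda> / q x)"
      by (metis of_real_mult of_real_1 of_real_diff)
    hence "e x * of_real (k x) + \<i> * of_real (\<phi>1 x) * e x * of_real (h x) = \<i> * e x - g x"
    proof -
      have "\<i> * of_real (\<phi>1 x) * e x * of_real (h x) = \<i> * e x * (of_real (\<phi>1 x) * of_real (h x))"
        by (simp only: mult_ac)
      also have "\<dots> = \<i> * e x * (1 - of_real (\<Lambda> / q x))"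
        using \<open>complex_of_real (\<phi>1 x) * of_real (h x) = 1 - of_real (\<Lambda> / q x)\<close> by simp
      finally show ?thesis unfolding g_def by (simp only: ring_distribs mult_ac) simp
    qed
    ultimately show ?thesis by (simp only:)
  qed
  have "((\<lambda>x. \<i> * e x - g x) has_integral e b * of_real (h b) - e a * of_real (h a)) {a..b}"
    by (rule fundamental_theorem_of_calculus[OF ab], rule has_vector_derivative_at_within, erule eh)
  moreover have gi: "g integrable_on {a..b}" by (rule integrable_continuous_interval[OF cg])
  ultimately have "((\<lambda>x. (\<i> * e x - g x) + g x) has_integral
      (e b * of_real (h b) - e a * of_real (h a) + integral {a..b} g)) {a..b}"
    by (intro has_integral_add) auto
  hence "((\<lambda>x. \<i> * e x) has_integral
      (e b * of_real (h b) - e a * of_real (h a) + integral {a..b} g)) {a..b}" by simp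
  hence main: "\<i> * integral {a..b} e = e b * of_real (h b) - e a * of_real (h a) + integral {a..b} g"
    using integral_mult_right[of "{a..b}" "\<i>" e] by (simp only: integral_unique)
  have hb: "\<bar>h x\<bar> \<le> 1 / (2 * sqrt \<Lambda>)" for x
  proof -
    have "0 \<le> (\<bar>\<phi>1 x\<bar> - sqrt \<Lambda>)\<^sup>2" by simp
    hence "2 * sqrt \<Lambda> * \<bar>\<phi>1 x\<bar> \<le> q x"
      using \<Lambda> by (simp add: q_def power2_diff mult_ac)
    thus ?thesis using q[of x] \<Lambda> by (simp add: h_def field_simps)
  qed
  have ne: "norm (e x) = 1" for x by (simp add: e_def)
  define G where "G x = 2 * (\<phi>2 x / q x) + 1 / sqrt \<Lambda>" for x
  have ng: "norm (g x) \<le> G x" if x: "x \<in> {a..b}" for x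
  proof -
    have "norm (g x) \<le> \<Lambda> / q x + \<bar>k x\<bar>"
      unfolding g_def norm_mult ne using q[of x] \<Lambda>
      by (intro order_trans[OF _ norm_triangle_ineq4] order_trans[OF norm_triangle_ineq4] | simp add: norm_mult norm_divide)+
    moreover have "\<bar>k x\<bar> \<le> \<phi>2 x / q x"
    proof -
      have "\<bar>\<Lambda> - (\<phi>1 x)\<^sup>2\<bar> \<le> q x" using \<Lambda> by (auto simp: q_def abs_if)
      hence "\<phi>2 x * \<bar>\<Lambda> - (\<phi>1 x)\<^sup>2\<bar> / (q x)\<^sup>2 \<le> \<phi>2 x * q x / (q x)\<^sup>2"
        using pos[OF x] by (intro divide_right_mono mult_left_mono) auto
      thus ?thesis using q[of x] pos[OF x] by (simp add: k_def abs_mult power2_eq_square)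
    qed
    moreover have "\<Lambda> / q x \<le> \<phi>2 x / q x + 1 / sqrt \<Lambda>"
      using big[OF x]
    proof
      assume "\<phi>2 x \<ge> \<Lambda>"
      hence "\<Lambda> / q x \<le> \<phi>2 x / q x" using q[of x] by (simp add: divide_right_mono)
      thus ?thesis using \<Lambda> by (smt (verit) divide_nonneg_nonneg real_sqrt_ge_zero)
    next
      assume "(\<phi>1 x)\<^sup>2 \<ge> \<Lambda> * sqrt \<Lambda>"
      hence "\<Lambda> * sqrt \<Lambda> \<le> q x" using \<Lambda> by (simp add: q_def)
      hence "\<Lambda> / q x \<le> 1 / sqrt \<Lambda>" using \<Lambda> q[of x] by (simp add: field_simps)
      moreover have "\<phi>2 x / q x \<ge> 0" using q[of x] pos[OF x] by simp
      ultimately show ?thesis by simp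
    qed
    ultimately show ?thesis by (simp add: G_def)
  qed
  have "((\<lambda>x. \<phi>2 x / q x) has_integral
      arctan (\<phi>1 b / sqrt \<Lambda>) / sqrt \<Lambda> - arctan (\<phi>1 a / sqrt \<Lambda>) / sqrt \<Lambda>) {a..b}"
  proof (rule fundamental_theorem_of_calculus[OF ab])
    fix x assume x: "x \<in> {a..b}"
    have *: "(sqrt \<Lambda>)\<^sup>2 = \<Lambda>" "sqrt \<Lambda> > 0" using \<Lambda> by auto
    have eq: "inverse (1 + (\<phi>1 x / sqrt \<Lambda>)\<^sup>2) * (\<phi>2 x / sqrt \<Lambda>) / sqrt \<Lambda> = \<phi>2 x / q x"
    proof -
      have "1 + (\<phi>1 x / sqrt \<Lambda>)\<^sup>2 = q x / \<Lambda>" using \<Lambda> by (simp add: q_def power_divide field_simps)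
      hence "inverse (1 + (\<phi>1 x / sqrt \<Lambda>)\<^sup>2) * (\<phi>2 x / sqrt \<Lambda>) / sqrt \<Lambda> = \<Lambda> / q x * \<phi>2 x / (sqrt \<Lambda> * sqrt \<Lambda>)"
        by simp
      also have "sqrt \<Lambda> * sqrt \<Lambda> = \<Lambda>" using \<Lambda> by simp
      finally show ?thesis using \<Lambda> by simp
    qed
    have "((\<lambda>x. arctan (\<phi>1 x / sqrt \<Lambda>) / sqrt \<Lambda>) has_real_derivative
        inverse (1 + (\<phi>1 x / sqrt \<Lambda>)\<^sup>2) * (\<phi>2 x / sqrt \<Lambda>) / sqrt \<Lambda>) (at x within {a..b})"
      by (intro DERIV_cdivide DERIV_chain2[OF DERIV_arctan]
          has_field_derivative_at_within[OF d2[OF x]])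
    thus "((\<lambda>x. arctan (\<phi>1 x / sqrt \<Lambda>) / sqrt \<Lambda>) has_vector_derivative \<phi>2 x / q x) (at x within {a..b})"
      unfolding eq by (simp add: has_real_derivative_iff_has_vector_derivative)
  qed
  hence GI: "(G has_integral 2 * (arctan (\<phi>1 b / sqrt \<Lambda>) / sqrt \<Lambda> - arctan (\<phi>1 a / sqrt \<Lambda>) / sqrt \<Lambda>)
       + (1 / sqrt \<Lambda>) * (b - a)) {a..b}"
    unfolding G_def using has_integral_const_real[of "1 / sqrt \<Lambda>" a b] ab
    by (intro has_integral_add has_integral_mult_right) (auto simp: mult.commute)
  have "arctan (\<phi>1 b / sqrt \<Lambda>) - arctan (\<phi>1 a / sqrt \<Lambda>) \<le> pi"
    using arctan_bounded[of "\<phi>1 b / sqrt \<Lambda>"] arctan_bounded[of "\<phi>1 a / sqrt \<Lambda>"] by linarith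
  hence at: "arctan (\<phi>1 b / sqrt \<Lambda>) / sqrt \<Lambda> - arctan (\<phi>1 a / sqrt \<Lambda>) / sqrt \<Lambda> \<le> pi / sqrt \<Lambda>"
    using \<Lambda> by (simp add: diff_divide_distrib[symmetric] divide_right_mono)
  have "norm (integral {a..b} g) \<le> integral {a..b} G"
    using ng gi GI by (intro integral_norm_bound_integral) auto
  also have "\<dots> \<le> 2 * (pi / sqrt \<Lambda>) + (1 / sqrt \<Lambda>) * (b - a)"
    unfolding integral_unique[OF GI] using at by simp
  finally have 1: "norm (integral {a..b} g) \<le> 2 * (pi / sqrt \<Lambda>) + (1 / sqrt \<Lambda>) * (b - a)" .
  have "norm (integral {a..b} e) = norm (\<i> * integral {a..b} e)" by (simp add: norm_mult)
  also have "\<dots> \<le> norm (e b * of_real (h b)) + norm (e a * of_real (h a)) + norm (integral {a..b} g)"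
    unfolding main by (meson add_mono norm_triangle_ineq norm_triangle_ineq4 order_trans order_refl)
  also have "\<dots> \<le> 1 / (2 * sqrt \<Lambda>) + 1 / (2 * sqrt \<Lambda>) + (2 * (pi / sqrt \<Lambda>) + (1 / sqrt \<Lambda>) * (b - a))"
    by (intro add_mono 1) (simp_all add: norm_mult ne hb del: divide_le_eq_1)
  also have "\<dots> = (1 + 2 * pi + (b - a)) / sqrt \<Lambda>" using \<Lambda> by (simp add: field_simps)
  finally show ?thesis by (simp add: e_def[abs_def])
qed

text \<open>The comparison measure: it is the parameter \<open>t\<close>, not the arc length, that is uniformly
  distributed. The two are comparable because the slope of \<open>\<psi>\<close> is bounded on \<open>[-1, 1]\<close>.\<close>
definition graph_measure :: "(real \<Rightarrow> real) \<Rightarrow> (real \<times> real) measure" where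
  "graph_measure \<psi> = distr (restrict_space lborel {-1..1}) borel (\<lambda>t. (t, \<psi> t))"

lemma sets_graph_measure [simp, measurable_cong]: "sets (graph_measure \<psi>) = sets borel"
  by (simp add: graph_measure_def)

text \<open>The bounds are required on \<open>[-3, 3]\<close> because the argument also uses points \<open>c + d - a\<close>
  with \<open>a\<close>, \<open>c\<close>, \<open>d\<close> in \<open>[-1, 1]\<close>. All constants below depend on \<open>\<psi>\<close> through \<open>L\<close>, \<open>lam\<close> and the
  decay constant \<open>D\<close> only.\<close>
locale convex_graph =
  fixes \<psi> \<psi>1 \<psi>2 :: "real \<Rightarrow> real" and L lam :: real
  assumes deriv1: "\<And>x. (\<psi> has_real_derivative \<psi>1 x) (at x)"
    and deriv2: "\<And>x. (\<psi>1 has_real_derivative \<psi>2 x) (at x)"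
    and cont2: "continuous_on UNIV \<psi>2"
    and L_ge_1: "L \<ge> 1" and lam_pos: "lam > 0" and lam_le_1: "lam \<le> 1"
    and slope_le: "\<And>x. \<bar>x\<bar> \<le> 3 \<Longrightarrow> \<bar>\<psi>1 x\<bar> \<le> L"
    and lam_le: "\<And>x. \<bar>x\<bar> \<le> 3 \<Longrightarrow> lam \<le> \<psi>2 x"
begin

lemma continuous_on_\<psi>: "continuous_on A \<psi>"
  using deriv1 by (auto intro!: continuous_at_imp_continuous_on DERIV_isCont)

lemma measurable_\<psi> [measurable]: "\<psi> \<in> borel_measurable borel"
  by (intro borel_measurable_continuous_onI continuous_on_\<psi>)

lemma measurable_graph: "(\<lambda>t. (t, \<psi> t)) \<in> restrict_space lborel {-1..1} \<rightarrow>\<^sub>M borel"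
  by (intro measurable_restrict_space1) simp

lemma finite_graph_measure: "finite_measure (graph_measure \<psi>)"
  unfolding graph_measure_def
  by (intro finite_measure.finite_measure_distr measurable_graph)
     (auto intro!: finite_measureI simp: emeasure_restrict_space)

lemma nn_integral_graph_measure:
  assumes [measurable]: "f \<in> borel_measurable borel"
  shows "(\<integral>\<^sup>+y. f y \<partial>graph_measure \<psi>) = (\<integral>\<^sup>+u. f (u, \<psi> u) * indicator {-1..1} u \<partial>lborel)"
  unfolding graph_measure_def
  by (subst nn_integral_distr[OF measurable_graph]) (auto simp: nn_integral_restrict_space)

lemma fourier_graph_measure:
  "fourier_measure (graph_measure \<psi>) \<xi> = integral {-1..1} (\<lambda>t. exp (- 2 * of_real pi * \<i> * of_real ((t, \<psi> t) \<bullet> \<xi>)))"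
proof -
  have "fourier_measure (graph_measure \<psi>) \<xi> =
     (LINT t:{-1..1}|lborel. exp (- 2 * of_real pi * \<i> * of_real ((t, \<psi> t) \<bullet> \<xi>)))"
    unfolding fourier_measure_def graph_measure_def set_lebesgue_integral_def
    by (subst integral_distr[OF measurable_graph]) (auto simp: integral_restrict_space)
  also have "\<dots> = integral {-1..1} (\<lambda>t. exp (- 2 * of_real pi * \<i> * of_real ((t, \<psi> t) \<bullet> \<xi>)))"
    by (intro set_borel_integral_eq_integral borel_integrable_atLeastAtMost' continuous_intros continuous_on_\<psi>)
  finally show ?thesis .
qed

text \<open>If \<open>\<xi>\<close> is nearly horizontal, the phase has no stationary point and a derivative of size
  \<open>norm \<xi>\<close>; otherwise its second derivative is at least a multiple of \<open>norm \<xi>\<close>. Complex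
  conjugation reduces to \<open>snd \<xi> \<ge> 0\<close>, where the phase is convex. The \<open>max\<close> avoids the
  singularity of the decay rate at the origin.\<close>
lemma fourier_graph_decay:
  "\<exists>D>0. \<forall>\<xi>. norm (fourier_measure (graph_measure \<psi>) \<xi>) \<le> D / sqrt (max 1 (norm \<xi>))"
proof -
  define c where "c = min 1 (lam / (2 * L + 1))"
  have c: "0 < c" "c \<le> 1" using lam_pos L_ge_1 by (auto simp: c_def)
  define D where "D = (3 + 2 * pi) / sqrt c"
  have upper: "norm (fourier_measure (graph_measure \<psi>) \<xi>) \<le> D / sqrt (norm \<xi>)"
    if n: "norm \<xi> \<ge> 1" and p: "snd \<xi> \<ge> 0" for \<xi>
  proof -
    obtain a b where \<xi>: "\<xi> = (a, b)" by force
    have b: "b \<ge> 0" using p \<xi> by simp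
    have nle: "norm \<xi> \<le> \<bar>a\<bar> + b" using norm_Pair_le[of a b] b \<xi> by simp
    define \<Lambda> where "\<Lambda> = c * norm \<xi>"
    have n0: "norm \<xi> > 0" using n by linarith
    have \<Lambda>: "0 < \<Lambda>" "\<Lambda> \<le> norm \<xi>" using c n n0 by (auto simp: \<Lambda>_def mult_le_cancel_right2)
    define \<phi> where "\<phi> x = 2 * pi * (x * a + \<psi> x * b)" for x
    have "norm (integral {-1..1} (\<lambda>x. exp (\<i> * of_real (\<phi> x)))) \<le> (1 + 2 * pi + (1 - (- 1))) / sqrt \<Lambda>"
    proof (rule oscillatory_integral_bound[where ?\<phi>1.0 = "\<lambda>x. 2 * pi * (a + \<psi>1 x * b)" and ?\<phi>2.0 = "\<lambda>x. 2 * pi * (\<psi>2 x * b)"])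
      show "(\<phi> has_real_derivative 2 * pi * (a + \<psi>1 x * b)) (at x)" for x
        unfolding \<phi>_def by (auto intro!: derivative_eq_intros deriv1)
      show "((\<lambda>x. 2 * pi * (a + \<psi>1 x * b)) has_real_derivative 2 * pi * (\<psi>2 x * b)) (at x)" for x
        by (auto intro!: derivative_eq_intros deriv2)
      show "continuous_on {- 1..1} (\<lambda>x. 2 * pi * (\<psi>2 x * b))"
        by (intro continuous_intros continuous_on_subset[OF cont2]) auto
      fix x :: real assume "x \<in> {-1..1}"
      hence x: "\<bar>x\<bar> \<le> 3" by auto
      show "0 \<le> 2 * pi * (\<psi>2 x * b)" using lam_le[OF x] lam_pos b by simp
      show "\<Lambda> \<le> 2 * pi * (\<psi>2 x * b) \<or> \<Lambda> * sqrt \<Lambda> \<le> (2 * pi * (a + \<psi>1 x * b))\<^sup>2"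
      \<comment> \<open>a nearly horizontal frequency: the slope term cannot cancel \<open>a\<close>\<close>
      proof (cases "\<bar>a\<bar> \<ge> 2 * L * b")
        case True
        have "\<bar>\<psi>1 x * b\<bar> \<le> L * b" using slope_le[OF x] b by (simp add: abs_mult mult_right_mono)
        hence "\<bar>a\<bar> / 2 \<le> \<bar>a + \<psi>1 x * b\<bar>" using True by linarith
        hence "2 * \<bar>a\<bar> \<le> 4 * \<bar>a + \<psi>1 x * b\<bar>" by simp
        moreover have "1 * b \<le> L * b" using L_ge_1 b by (intro mult_right_mono)
        hence "norm \<xi> \<le> 2 * \<bar>a\<bar>" using nle True b by linarith
        ultimately have "norm \<xi> \<le> 4 * \<bar>a + \<psi>1 x * b\<bar>" by (rule order_trans[rotated])
        also have "\<dots> \<le> \<bar>2 * pi * (a + \<psi>1 x * b)\<bar>"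
          unfolding abs_mult using pi_gt3 by (intro mult_right_mono) auto
        finally have "(norm \<xi>)\<^sup>2 \<le> (2 * pi * (a + \<psi>1 x * b))\<^sup>2" by (simp add: abs_le_square_iff[symmetric])
        moreover have "sqrt \<Lambda> \<le> norm \<xi>"
          using \<Lambda>(2) self_le_power[OF n, of 2] by (intro real_le_lsqrt) auto
        hence "\<Lambda> * sqrt \<Lambda> \<le> norm \<xi> * norm \<xi>" using \<Lambda> by (intro mult_mono) auto
        ultimately show ?thesis by (simp add: power2_eq_square)
      next
        case False
        hence "norm \<xi> \<le> (2 * L + 1) * b" using nle by (simp add: algebra_simps)
        hence "c * norm \<xi> \<le> (lam / (2 * L + 1)) * ((2 * L + 1) * b)"
          using c b L_ge_1 by (intro mult_mono) (auto simp: c_def)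
        also have "\<dots> = lam * b" using L_ge_1 by simp
        also have "\<dots> \<le> \<psi>2 x * b" using lam_le[OF x] b by (intro mult_right_mono)
        also have "\<dots> = 1 * (\<psi>2 x * b)" by simp
        also have "\<dots> \<le> 2 * pi * (\<psi>2 x * b)" using lam_le[OF x] lam_pos b pi_gt3 by (intro mult_right_mono) auto
        finally show ?thesis by (simp add: \<Lambda>_def)
      qed
    qed (use \<Lambda> in auto)
    also have "\<dots> = D / sqrt (norm \<xi>)" by (simp add: D_def \<Lambda>_def real_sqrt_mult)
    also have "integral {-1..1} (\<lambda>x. exp (\<i> * of_real (\<phi> x))) = cnj (fourier_measure (graph_measure \<psi>) \<xi>)"
      unfolding fourier_graph_measure
      by (simp add: integral_cnj exp_cnj \<phi>_def \<xi> mult_ac)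
    finally show ?thesis by simp
  qed
  have neg: "norm (fourier_measure (graph_measure \<psi>) (- \<xi>)) = norm (fourier_measure (graph_measure \<psi>) \<xi>)" for \<xi>
  proof -
    have "fourier_measure (graph_measure \<psi>) (- \<xi>) = cnj (fourier_measure (graph_measure \<psi>) \<xi>)"
      unfolding fourier_graph_measure by (simp add: integral_cnj exp_cnj)
    thus ?thesis by simp
  qed
  have "D > 0" using c pi_gt3 by (simp add: D_def)
  moreover have "norm (fourier_measure (graph_measure \<psi>) \<xi>) \<le> D / sqrt (max 1 (norm \<xi>))" for \<xi>
  proof (cases "norm \<xi> \<ge> 1")
    case True
    thus ?thesis using upper[of \<xi>] upper[of "- \<xi>"] neg[of \<xi>] by (cases "snd \<xi> \<ge> 0") (auto simp: max_def)
  next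
    case False
    have "norm (fourier_measure (graph_measure \<psi>) \<xi>) \<le> 2"
    proof -
      have "measure (graph_measure \<psi>) UNIV = 2"
        unfolding graph_measure_def
        by (subst measure_distr[OF measurable_graph]) (auto simp: measure_restrict_space space_restrict_space)
      with norm_fourier_measure_le[OF finite_graph_measure sets_graph_measure, of \<xi>]
      show ?thesis by simp
    qed
    also have "2 \<le> D"
    proof -
      have "(3 + 2 * pi) * 1 \<le> (3 + 2 * pi) * (1 / sqrt c)" using c pi_gt3 by (intro mult_left_mono) auto
      thus ?thesis using pi_gt3 by (simp add: D_def)
    qed
    finally show ?thesis using False by simp
  qed
  ultimately show ?thesis by blast
qed

end

section \<open>Frostman measures on the graph\<close>

lemma AE_measure_support:
  fixes \<sigma> :: "'a::second_countable_topology measure"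
  assumes sets: "sets \<sigma> = sets borel"
  shows "AE x in \<sigma>. x \<in> measure_support \<sigma>"
proof -
  obtain B :: "'a set set" where B: "countable B" "topological_basis B"
    using ex_countable_basis by blast
  let ?N = "\<Union>{b \<in> B. emeasure \<sigma> b = 0}"
  have "?N \<in> null_sets \<sigma>"
  proof (rule null_sets_UN'[of "{b \<in> B. emeasure \<sigma> b = 0}" "\<lambda>b. b", simplified])
    show "countable {b \<in> B. emeasure \<sigma> b = 0}" using B(1) by (rule countable_subset[rotated]) auto
    show "b \<in> null_sets \<sigma>" if "b \<in> B \<and> emeasure \<sigma> b = 0" for b
      using that topological_basis_open[OF B(2)] sets by auto
  qed
  moreover have "{x \<in> space \<sigma>. x \<notin> measure_support \<sigma>} \<subseteq> ?N"
  proof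
    fix x assume "x \<in> {x \<in> space \<sigma>. x \<notin> measure_support \<sigma>}"
    then obtain U where U: "open U" "x \<in> U" "emeasure \<sigma> U = 0"
      by (auto simp: measure_support_def)
    obtain b where b: "b \<in> B" "x \<in> b" "b \<subseteq> U"
      using topological_basisE[OF B(2) U(1,2)] by blast
    have "emeasure \<sigma> b \<le> emeasure \<sigma> U" using b U sets by (intro emeasure_mono) auto
    thus "x \<in> ?N" using b U by auto
  qed
  ultimately show ?thesis by (rule AE_I'[OF _ _])
qed

lemma borel_measurable_fst [measurable]:
  "(fst :: 'a::topological_space \<times> 'b::topological_space \<Rightarrow> 'a) \<in> borel_measurable borel"
  by (intro borel_measurable_continuous_onI continuous_intros)

lemma (in convex_graph) lipschitz_\<psi>:
  assumes "\<bar>x\<bar> \<le> 3" "\<bar>y\<bar> \<le> 3"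
  shows "\<bar>\<psi> x - \<psi> y\<bar> \<le> L * \<bar>x - y\<bar>"
proof -
  have "norm (\<psi> x - \<psi> y) \<le> L * norm (x - y)"
    by (rule field_differentiable_bound[where S = "{-3..3}" and f' = \<psi>1])
       (use assms slope_le in \<open>auto intro: has_field_derivative_at_within deriv1\<close>)
  thus ?thesis by simp
qed

lemma (in convex_graph) dist_graph_le:
  assumes "\<bar>x\<bar> \<le> 1" "\<bar>y\<bar> \<le> 1"
  shows "dist (x, \<psi> x) (y, \<psi> y) \<le> (1 + L) * \<bar>x - y\<bar>"
proof -
  have "dist (x, \<psi> x) (y, \<psi> y) \<le> norm (x - y) + norm (\<psi> x - \<psi> y)"
    using norm_Pair_le[of "x - y" "\<psi> x - \<psi> y"] by (simp only: dist_norm diff_Pair)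
  also have "\<dots> \<le> (1 + L) * \<bar>x - y\<bar>"
    using lipschitz_\<psi>[of x y] assms by (simp add: algebra_simps)
  finally show ?thesis .
qed

text \<open>The decay constant \<open>D\<close> is a parameter, and not obtained inside, so that it is chosen
  before the measure \<open>\<sigma>\<close> and the final constant is visibly independent of \<open>\<sigma>\<close>.\<close>
locale frostman_on_graph = convex_graph +
  fixes s D :: real and \<sigma> :: "(real \<times> real) measure"
  assumes s_ge: "2 / 3 \<le> s" and s_le: "s \<le> 1"
    and frostman_\<sigma>: "frostman s \<sigma>" and support_\<sigma>: "measure_support \<sigma> \<subseteq> curve \<psi>"
    and D_pos: "D > 0"
    and decay: "\<And>\<xi>. norm (fourier_measure (graph_measure \<psi>) \<xi>) \<le> D / sqrt (max 1 (norm \<xi>))"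
begin

text \<open>A Lipschitz constant of the parametrisation of the graph.\<close>
definition K :: real where "K = 1 + L"

lemma K_ge_2: "K \<ge> 2" using L_ge_1 by (simp add: K_def)

lemma sets_\<sigma> [simp, measurable_cong]: "sets \<sigma> = sets borel"
  using frostman_\<sigma> by (simp add: frostman_def)

lemma space_\<sigma> [simp]: "space \<sigma> = UNIV"
  using sets_eq_imp_space_eq[OF sets_\<sigma>] by simp

lemma emeasure_ball_le: "r > 0 \<Longrightarrow> emeasure \<sigma> (ball x r) \<le> ennreal (r powr s)"
  using frostman_\<sigma> unfolding frostman_def by blast

lemma AE_graph: "AE x in \<sigma>. \<bar>fst x\<bar> \<le> 1 \<and> x = (fst x, \<psi> (fst x))"
  using AE_measure_support[OF sets_\<sigma>]
proof eventually_elim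
  case (elim x)
  thus ?case using support_\<sigma> by (force simp: curve_def)
qed

lemma emeasure_slab_le:
  assumes "\<bar>a\<bar> \<le> 1" "t > 0"
  shows "emeasure \<sigma> {x. \<bar>fst x - a\<bar> \<le> t} \<le> ennreal ((2 * K * t) powr s)"
proof -
  have "emeasure \<sigma> {x. \<bar>fst x - a\<bar> \<le> t} \<le> emeasure \<sigma> (ball (a, \<psi> a) (2 * K * t))"
  proof (rule emeasure_mono_AE)
    show "AE x in \<sigma>. x \<in> {x. \<bar>fst x - a\<bar> \<le> t} \<longrightarrow> x \<in> ball (a, \<psi> a) (2 * K * t)"
      using AE_graph
    proof eventually_elim
      case (elim x)
      show ?case
      proof
        assume "x \<in> {x. \<bar>fst x - a\<bar> \<le> t}"
        hence "dist (fst x, \<psi> (fst x)) (a, \<psi> a) \<le> K * t"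
          using dist_graph_le[of "fst x" a] elim assms K_ge_2
          by (intro order_trans[OF dist_graph_le[of "fst x" a]]) (auto simp: K_def)
        moreover have "K * t < 2 * K * t" using K_ge_2 assms by simp
        ultimately have "dist (fst x, \<psi> (fst x)) (a, \<psi> a) < 2 * K * t" by (rule le_less_trans)
        thus "x \<in> ball (a, \<psi> a) (2 * K * t)"
          using elim by (simp add: dist_commute)
      qed
    qed
  qed simp
  also have "\<dots> \<le> ennreal ((2 * K * t) powr s)"
    using assms K_ge_2 by (intro emeasure_ball_le) simp
  finally show ?thesis .
qed

lemma powr_s_le: "1 \<le> x \<Longrightarrow> x powr s \<le> x"
  using powr_mono[of s 1 x] s_le by simp

lemma emeasure_UNIV_le': "emeasure \<sigma> UNIV \<le> ennreal ((2 * K) powr s)"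
proof -
  have "emeasure \<sigma> UNIV = emeasure \<sigma> {x. \<bar>fst x - 0\<bar> \<le> 1}"
  proof (rule emeasure_eq_AE)
    show "AE x in \<sigma>. x \<in> UNIV \<longleftrightarrow> x \<in> {x. \<bar>fst x - 0\<bar> \<le> 1}" using AE_graph by eventually_elim auto
    show "{x. \<bar>fst x - 0\<bar> \<le> 1} \<in> sets \<sigma>" unfolding sets_\<sigma> by measurable
  qed simp
  thus ?thesis using emeasure_slab_le[of 0 1] by simp
qed

lemma emeasure_UNIV_le: "emeasure \<sigma> UNIV \<le> ennreal (2 * K)"
  by (rule order_trans[OF emeasure_UNIV_le' ennreal_leI[OF powr_s_le]]) (use K_ge_2 in simp)

lemma finite_\<sigma>: "finite_measure \<sigma>"
  using emeasure_UNIV_le by (intro finite_measureI) (auto simp: top_unique)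

text \<open>At scale \<open>1 / R\<close> the measure \<open>\<sigma>\<close> is at most \<open>R\<^sup>1\<^sup>-\<^sup>s\<close> times the uniform measure on the
  graph: an interval of length about \<open>1 / R\<close> of the curve has \<open>\<sigma>\<close>-mass of order at most \<open>R\<^sup>-\<^sup>s\<close> and uniform
  mass about \<open>1 / R\<close>. Moving a point by \<open>1 / R\<close> changes the Gaussian by a bounded factor, provided
  that the Gaussian on the right is a little wider; hence \<open>R / sqrt 2\<close>.\<close>
lemma gaussian_domination:
  assumes R: "R \<ge> 1"
  shows "(\<integral>\<^sup>+x. ennreal (gauss R (z + x)) \<partial>\<sigma>)
     \<le> ennreal (2 * exp pi * K * R powr (1 - s)) * (\<integral>\<^sup>+y. ennreal (gauss (R / sqrt 2) (z + y)) \<partial>graph_measure \<psi>)"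
proof -
  interpret finite_measure \<sigma> by (rule finite_\<sigma>)
  interpret P: pair_sigma_finite \<sigma> "lborel :: real measure" ..
  define \<delta> where "\<delta> = 1 / (K * R)"
  define g where "g u = ennreal (gauss (R / sqrt 2) (z + (u, \<psi> u))) * indicator {-1..1} u" for u
  have gm [measurable]: "g \<in> borel_measurable borel" unfolding g_def by measurable
  have KR: "K * R > 0" "K * R \<ge> 1" using K_ge_2 R by (auto simp: mult_ge1_I)
  have \<delta>: "\<delta> > 0" "\<delta> \<le> 1" "K * \<delta> = 1 / R" using KR K_ge_2 R by (auto simp: \<delta>_def)
  have pt: "ennreal (gauss R (z + x)) \<le> ennreal (exp pi * K * R) * (\<integral>\<^sup>+u. g u * indicator {u. \<bar>fst x - u\<bar> \<le> \<delta>} u \<partial>lborel)"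
    if x: "\<bar>fst x\<bar> \<le> 1 \<and> x = (fst x, \<psi> (fst x))" for x
  proof -
    define t where "t = fst x"
    have t: "\<bar>t\<bar> \<le> 1" "x = (t, \<psi> t)" using x by (auto simp: t_def)
    \<comment> \<open>a one-sided interval, since \<open>t\<close> may be an end point of \<open>[-1, 1]\<close>\<close>
    define J where "J = (if t \<le> 0 then {t..t + \<delta>} else {t - \<delta>..t})"
    have J: "J \<subseteq> {-1..1}" "J \<subseteq> {u. \<bar>t - u\<bar> \<le> \<delta>}" using t(1) \<delta> by (auto simp: J_def split: if_splits)
    have Jm [measurable]: "J \<in> sets borel" by (simp add: J_def)
    have Jl: "emeasure lborel J = ennreal \<delta>" using \<delta> by (simp add: J_def)
    have low: "exp (- pi) * gauss R (z + x) \<le> gauss (R / sqrt 2) (z + (u, \<psi> u))" if u: "u \<in> J" for u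
    proof -
      have "norm ((u, \<psi> u) - x) \<le> K * \<bar>u - t\<bar>"
        using dist_graph_le[of u t] t J(1) u by (force simp: dist_norm K_def)
      also have "\<dots> \<le> K * \<delta>" using J(2) u K_ge_2 by (intro mult_left_mono) auto
      finally have d: "norm ((u, \<psi> u) - x) \<le> 1 / R" using \<delta> by simp
      define p where "p = norm (z + x)"
      have "norm (z + (u, \<psi> u)) \<le> p + 1 / R"
        using norm_triangle_ineq[of "z + x" "(u, \<psi> u) - x"] d by (simp add: p_def algebra_simps)
      hence "R * norm (z + (u, \<psi> u)) \<le> R * p + 1" using R
        using mult_left_mono[of "norm (z + (u, \<psi> u))" "p + 1 / R" R] by (simp add: distrib_left)
      hence "(R * norm (z + (u, \<psi> u)))\<^sup>2 \<le> (R * p + 1)\<^sup>2" using R by (intro power_mono) auto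
      also have "\<dots> \<le> 2 * (R * p)\<^sup>2 + 2"
        using zero_le_power2[of "R * p - 1"] by (simp add: power2_eq_square algebra_simps)
      finally have "(R * norm (z + (u, \<psi> u)))\<^sup>2 / 2 \<le> (R * p)\<^sup>2 + 1" by simp
      hence "pi * ((R * norm (z + (u, \<psi> u)))\<^sup>2 / 2) \<le> pi * ((R * p)\<^sup>2 + 1)" by (intro mult_left_mono) auto
      thus ?thesis by (simp add: gauss_def p_def exp_add[symmetric] power_mult_distrib power_divide field_simps)
    qed
    have "ennreal (exp (- pi) * gauss R (z + x) * \<delta>) = (\<integral>\<^sup>+u. ennreal (exp (- pi) * gauss R (z + x)) * indicator J u \<partial>lborel)"
      using \<delta> by (simp add: nn_integral_cmult_indicator Jl ennreal_mult' gauss_pos less_imp_le)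
    also have "\<dots> \<le> (\<integral>\<^sup>+u. g u * indicator {u. \<bar>fst x - u\<bar> \<le> \<delta>} u \<partial>lborel)"
    proof (rule nn_integral_mono)
      fix u
      show "ennreal (exp (- pi) * gauss R (z + x)) * indicator J u \<le> g u * indicator {u. \<bar>fst x - u\<bar> \<le> \<delta>} u"
      proof (cases "u \<in> J")
        case True
        hence "u \<in> {-1..1}" "u \<in> {u. \<bar>t - u\<bar> \<le> \<delta>}" using J by blast+
        thus ?thesis using low[OF True] True by (simp add: g_def t_def ennreal_leI)
      qed simp
    qed
    finally have 1: "ennreal (exp (- pi) * gauss R (z + x) * \<delta>) \<le> (\<integral>\<^sup>+u. g u * indicator {u. \<bar>fst x - u\<bar> \<le> \<delta>} u \<partial>lborel)" .
    have "gauss R (z + x) = (exp pi * K * R) * (exp (- pi) * gauss R (z + x) * \<delta>)"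
      using K_ge_2 R by (simp add: \<delta>_def exp_minus field_simps)
    hence "ennreal (gauss R (z + x)) = ennreal (exp pi * K * R) * ennreal (exp (- pi) * gauss R (z + x) * \<delta>)"
      using R K_ge_2 \<delta> gauss_pos[of R "z + x"]
      by (subst ennreal_mult[symmetric]) simp_all
    thus ?thesis using 1 by (simp add: mult_left_mono)
  qed
  have "(\<integral>\<^sup>+x. ennreal (gauss R (z + x)) \<partial>\<sigma>)
      \<le> (\<integral>\<^sup>+x. ennreal (exp pi * K * R) * (\<integral>\<^sup>+u. g u * indicator {u. \<bar>fst x - u\<bar> \<le> \<delta>} u \<partial>lborel) \<partial>\<sigma>)"
    by (rule nn_integral_mono_AE, use AE_graph in eventually_elim, rule pt)
  also have "\<dots> = ennreal (exp pi * K * R) * (\<integral>\<^sup>+x. (\<integral>\<^sup>+u. g u * indicator {u. \<bar>fst x - u\<bar> \<le> \<delta>} u \<partial>lborel) \<partial>\<sigma>)"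
    by (rule nn_integral_cmult) measurable
  also have "(\<integral>\<^sup>+x. (\<integral>\<^sup>+u. g u * indicator {u. \<bar>fst x - u\<bar> \<le> \<delta>} u \<partial>lborel) \<partial>\<sigma>)
      = (\<integral>\<^sup>+u. (\<integral>\<^sup>+x. g u * indicator {u. \<bar>fst x - u\<bar> \<le> \<delta>} u \<partial>\<sigma>) \<partial>lborel)"
    by (rule P.Fubini'[symmetric]) measurable
  also have "\<dots> = (\<integral>\<^sup>+u. g u * emeasure \<sigma> {x. \<bar>fst x - u\<bar> \<le> \<delta>} \<partial>lborel)"
  proof (rule nn_integral_cong)
    fix u
    have "(\<integral>\<^sup>+x. g u * indicator {u. \<bar>fst x - u\<bar> \<le> \<delta>} u \<partial>\<sigma>) = (\<integral>\<^sup>+x. g u * indicator {x. \<bar>fst x - u\<bar> \<le> \<delta>} x \<partial>\<sigma>)"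
      by (intro nn_integral_cong) (auto split: split_indicator)
    also have "\<dots> = g u * emeasure \<sigma> {x. \<bar>fst x - u\<bar> \<le> \<delta>}"
      by (intro nn_integral_cmult_indicator) measurable
    finally show "(\<integral>\<^sup>+x. g u * indicator {u. \<bar>fst x - u\<bar> \<le> \<delta>} u \<partial>\<sigma>) = g u * emeasure \<sigma> {x. \<bar>fst x - u\<bar> \<le> \<delta>}" .
  qed
  also have "\<dots> \<le> (\<integral>\<^sup>+u. g u * ennreal (2 * R powr (- s)) \<partial>lborel)"
  proof (rule nn_integral_mono)
    fix u
    show "g u * emeasure \<sigma> {x. \<bar>fst x - u\<bar> \<le> \<delta>} \<le> g u * ennreal (2 * R powr (- s))"
    proof (cases "u \<in> {-1..1}")
      case True
      have "emeasure \<sigma> {x. \<bar>fst x - u\<bar> \<le> \<delta>} \<le> ennreal ((2 * K * \<delta>) powr s)"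
        using True \<delta> by (intro emeasure_slab_le) auto
      also have "(2 * K * \<delta>) powr s = 2 powr s * R powr (- s)"
        using R by (simp only: mult.assoc \<delta>(3)) (simp add: powr_divide powr_minus field_simps)
      also have "ennreal (2 powr s * R powr (- s)) \<le> ennreal (2 * R powr (- s))"
        using powr_s_le[of 2] by (intro ennreal_leI mult_right_mono) auto
      finally show ?thesis by (intro mult_left_mono) auto
    qed (simp add: g_def)
  qed
  also have "\<dots> = ennreal (2 * R powr (- s)) * (\<integral>\<^sup>+u. g u \<partial>lborel)"
    by (subst mult.commute, rule nn_integral_cmult) measurable
  also have "(\<integral>\<^sup>+u. g u \<partial>lborel) = (\<integral>\<^sup>+y. ennreal (gauss (R / sqrt 2) (z + y)) \<partial>graph_measure \<psi>)"
    unfolding g_def by (subst nn_integral_graph_measure) auto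
  also have "ennreal (exp pi * K * R) * (ennreal (2 * R powr (- s)) * (\<integral>\<^sup>+y. ennreal (gauss (R / sqrt 2) (z + y)) \<partial>graph_measure \<psi>))
     = ennreal (exp pi * K * R * (2 * R powr (- s))) * (\<integral>\<^sup>+y. ennreal (gauss (R / sqrt 2) (z + y)) \<partial>graph_measure \<psi>)"
    using R K_ge_2 by (subst ennreal_mult) (auto simp: mult.assoc)
  also have "exp pi * K * R * (2 * R powr (- s)) = 2 * exp pi * K * R powr (1 - s)"
    using R by (simp add: powr_diff powr_minus field_simps)
  finally show ?thesis by (simp add: mult_left_mono)
qed

end

section \<open>The fourth moment: additive quadruples on the graph\<close>

lemma mean_value_between:
  fixes f f' :: "real \<Rightarrow> real"
  assumes "\<And>x. (f has_real_derivative f' x) (at x)"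
  obtains z where "min a b \<le> z" "z \<le> max a b" "f b - f a = (b - a) * f' z"
proof -
  consider "a < b" | "a = b" | "b < a" by linarith
  then show thesis
  proof cases
    case 1
    then obtain z where "a < z" "z < b" "f b - f a = (b - a) * f' z"
      using MVT2[of a b f f'] assms by blast
    thus thesis using that[of z] 1 by simp
  next
    case 2
    thus thesis using that[of a] by simp
  next
    case 3
    then obtain z where "b < z" "z < a" "f a - f b = (a - b) * f' z"
      using MVT2[of b a f f'] assms by blast
    thus thesis using that[of z] 3 by (simp add: algebra_simps)
  qed
qed

text \<open>If \<open>b\<close> equals \<open>e = c + d - a\<close>, then two applications of the mean value theorem show that
  \<open>\<psi> a + \<psi> b - \<psi> c - \<psi> d\<close> is \<open>(a - c) (a - d)\<close> times a value of \<open>\<psi>''\<close>; for a parabola this is the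
  usual factorisation. In general \<open>b\<close> is within \<open>\<delta>\<close> of \<open>e\<close>, which costs \<open>L \<delta>\<close>. So
  approximate solutions of \<open>a + b = c + d\<close> on the graph are close to the diagonal ones.\<close>
lemma (in convex_graph) four_points_on_graph:
  assumes a: "\<bar>a\<bar> \<le> 1" and b: "\<bar>b\<bar> \<le> 1" and c: "\<bar>c\<bar> \<le> 1" and d: "\<bar>d\<bar> \<le> 1"
    and \<delta>: "\<bar>a - c - d + b\<bar> \<le> \<delta>" "\<bar>\<psi> a - \<psi> c - \<psi> d + \<psi> b\<bar> \<le> \<delta>"
  shows "\<bar>a - c\<bar> * \<bar>a - d\<bar> \<le> (1 + L) / lam * \<delta>"
proof -
  define e where "e = c + d - a"
  have e: "\<bar>e\<bar> \<le> 3" using a c d by (simp add: e_def)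
  have "((\<lambda>t. \<psi> (c + t) - \<psi> (e + t)) has_real_derivative (\<psi>1 (c + t) - \<psi>1 (e + t))) (at t)" for t
    by (rule derivative_eq_intros DERIV_chain2[OF deriv1] | simp)+
  then obtain t where t: "min 0 (a - c) \<le> t" "t \<le> max 0 (a - c)"
    and 1: "(\<psi> (c + (a - c)) - \<psi> (e + (a - c))) - (\<psi> (c + 0) - \<psi> (e + 0))
       = (a - c - 0) * (\<psi>1 (c + t) - \<psi>1 (e + t))"
    by (rule mean_value_between[where a = 0 and b = "a - c"])
  obtain z where z: "min (e + t) (c + t) \<le> z" "z \<le> max (e + t) (c + t)"
    and 2: "\<psi>1 (c + t) - \<psi>1 (e + t) = (c + t - (e + t)) * \<psi>2 z"
    by (rule mean_value_between[OF deriv2, where a = "e + t" and b = "c + t"])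
  have "\<bar>c + t\<bar> \<le> 3" "\<bar>e + t\<bar> \<le> 3" using t a c d e by (auto simp: e_def min_def max_def split: if_splits)
  hence "\<bar>z\<bar> \<le> 3" using z by (auto simp: min_def max_def split: if_splits)
  hence zl: "lam \<le> \<psi>2 z" by (rule lam_le)
  have "\<psi> a - \<psi> d - \<psi> c + \<psi> e = (a - c) * ((a - d) * \<psi>2 z)"
    using 1 unfolding 2 by (simp add: e_def algebra_simps)
  hence eq: "\<bar>\<psi> a - \<psi> d - \<psi> c + \<psi> e\<bar> = \<bar>a - c\<bar> * \<bar>a - d\<bar> * \<psi>2 z"
    using zl lam_pos by (simp add: abs_mult)
  have "\<bar>\<psi> e - \<psi> b\<bar> \<le> L * \<bar>e - b\<bar>" using e b by (intro lipschitz_\<psi>) auto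
  also have "\<dots> \<le> L * \<delta>" using L_ge_1 \<delta>(1) by (intro mult_left_mono) (auto simp: e_def)
  finally have "\<bar>\<psi> a - \<psi> d - \<psi> c + \<psi> e\<bar> \<le> \<delta> + L * \<delta>" using \<delta>(2) by linarith
  moreover have "\<bar>a - c\<bar> * \<bar>a - d\<bar> * lam \<le> \<bar>a - c\<bar> * \<bar>a - d\<bar> * \<psi>2 z"
    using zl by (intro mult_left_mono) auto
  ultimately have "\<bar>a - c\<bar> * \<bar>a - d\<bar> * lam \<le> (1 + L) * \<delta>" unfolding eq by (simp add: algebra_simps)
  thus ?thesis using lam_pos by (simp add: field_simps)
qed

lemma dyadic_interval_cases:
  fixes t :: real
  assumes "t \<le> 2"
  shows "t \<le> 1 / 2 ^ n \<or> (\<exists>k\<le>n. 1 / 2 ^ k < t \<and> t \<le> 2 / 2 ^ k)"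
proof (induction n)
  case 0
  show ?case using assms by auto
next
  case (Suc n)
  show ?case
  proof (cases "t \<le> 1 / 2 ^ n")
    case True
    show ?thesis
    proof (cases "t \<le> 1 / 2 ^ Suc n")
      case False
      hence "1 / 2 ^ Suc n < t \<and> t \<le> 2 / 2 ^ Suc n" using True by simp
      thus ?thesis by blast
    qed simp
  next
    case False
    with Suc show ?thesis by (meson le_SucI)
  qed
qed

context frostman_on_graph
begin

text \<open>The hyperbolic region \<open>\<bar>a - c\<bar> \<bar>a - d\<bar> \<le> \<kappa>\<close> is covered by \<open>n + 1\<close> dyadic rectangles with sides
  about \<open>2\<^sup>-\<^sup>k\<close> and \<open>\<kappa> 2\<^sup>k\<close>, and each of them has product measure at most a constant times
  \<open>\<kappa>\<^sup>s\<close>.\<close>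
lemma nn_integral_product_le:
  assumes a: "\<bar>a\<bar> \<le> 1" and \<kappa>: "1 / 2 ^ n \<le> \<kappa>"
  shows "(\<integral>\<^sup>+c. emeasure \<sigma> {d. \<bar>a - fst c\<bar> * \<bar>a - fst d\<bar> \<le> \<kappa>} \<partial>\<sigma>)
     \<le> ennreal ((real n + 1) * (8 * K\<^sup>2 * \<kappa>) powr s)"
proof -
  have \<kappa>0: "\<kappa> > 0" using \<kappa> by (rule less_le_trans[rotated]) simp
  define w where "w k = (2 * K * (\<kappa> * 2 ^ k)) powr s" for k :: nat
  define S where "S k = {c :: real \<times> real. \<bar>fst c - a\<bar> \<le> 2 / 2 ^ k}" for k :: nat
  have Sm [measurable]: "S k \<in> sets borel" for k unfolding S_def by measurable
  have pt: "emeasure \<sigma> {d. \<bar>a - fst c\<bar> * \<bar>a - fst d\<bar> \<le> \<kappa>} \<le> (\<Sum>k\<le>n. ennreal (w k) * indicator (S k) c)"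
    if c: "\<bar>fst c\<bar> \<le> 1" for c
  proof -
    have "\<exists>k\<le>n. c \<in> S k \<and> emeasure \<sigma> {d. \<bar>a - fst c\<bar> * \<bar>a - fst d\<bar> \<le> \<kappa>} \<le> ennreal (w k)"
    proof -
      define t where "t = \<bar>a - fst c\<bar>"
      have "t \<le> 2" using a c by (simp add: t_def)
      then consider "t \<le> 1 / 2 ^ n" | k where "k \<le> n" "1 / 2 ^ k < t" "t \<le> 2 / 2 ^ k"
        using dyadic_interval_cases by blast
      thus ?thesis
      proof cases
        case 1
        have "emeasure \<sigma> {d. \<bar>a - fst c\<bar> * \<bar>a - fst d\<bar> \<le> \<kappa>} \<le> emeasure \<sigma> UNIV"
          by (intro emeasure_mono) auto
        also have "\<dots> \<le> ennreal ((2 * K) powr s)" by (rule emeasure_UNIV_le')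
        also have "1 \<le> \<kappa> * 2 ^ n" using \<kappa> by (simp add: field_simps)
        hence "(2 * K) powr s \<le> w n" unfolding w_def using K_ge_2 s_ge
          by (intro powr_mono2) (auto simp: mult_le_cancel_left1)
        finally have "emeasure \<sigma> {d. \<bar>a - fst c\<bar> * \<bar>a - fst d\<bar> \<le> \<kappa>} \<le> ennreal (w n)" by (simp add: ennreal_leI)
        moreover have "(1::real) / 2 ^ n \<le> 2 / 2 ^ n" by (simp add: divide_right_mono)
        hence "c \<in> S n" using 1 by (simp add: S_def t_def abs_minus_commute)
        ultimately show ?thesis by blast
      next
        case 2
        have "emeasure \<sigma> {d. \<bar>a - fst c\<bar> * \<bar>a - fst d\<bar> \<le> \<kappa>} \<le> emeasure \<sigma> {d. \<bar>fst d - a\<bar> \<le> \<kappa> * 2 ^ k}"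
        proof (rule emeasure_mono)
          show "{d. \<bar>a - fst c\<bar> * \<bar>a - fst d\<bar> \<le> \<kappa>} \<subseteq> {d. \<bar>fst d - a\<bar> \<le> \<kappa> * 2 ^ k}"
          proof
            fix d assume "d \<in> {d. \<bar>a - fst c\<bar> * \<bar>a - fst d\<bar> \<le> \<kappa>}"
            hence "t * \<bar>a - fst d\<bar> \<le> \<kappa>" by (simp add: t_def)
            moreover have "1 / 2 ^ k * \<bar>a - fst d\<bar> \<le> t * \<bar>a - fst d\<bar>" using 2 by (intro mult_right_mono) auto
            ultimately have "\<bar>a - fst d\<bar> / 2 ^ k \<le> \<kappa>" by simp
            thus "d \<in> {d. \<bar>fst d - a\<bar> \<le> \<kappa> * 2 ^ k}" by (simp add: field_simps abs_minus_commute)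
          qed
        qed (unfold sets_\<sigma>, measurable)
        also have "\<dots> \<le> ennreal (w k)" unfolding w_def using \<kappa>0 by (intro emeasure_slab_le a) simp
        finally show ?thesis using 2 by (auto simp: S_def t_def abs_minus_commute)
      qed
    qed
    then obtain k where k: "k \<le> n" "c \<in> S k" "emeasure \<sigma> {d. \<bar>a - fst c\<bar> * \<bar>a - fst d\<bar> \<le> \<kappa>} \<le> ennreal (w k)"
      by blast
    note k(3)
    also have "ennreal (w k) = ennreal (w k) * indicator (S k) c" using k by simp
    also have "\<dots> \<le> (\<Sum>k\<le>n. ennreal (w k) * indicator (S k) c)" using k by (intro member_le_sum) auto
    finally show ?thesis .
  qed
  have "(\<integral>\<^sup>+c. emeasure \<sigma> {d. \<bar>a - fst c\<bar> * \<bar>a - fst d\<bar> \<le> \<kappa>} \<partial>\<sigma>)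
     \<le> (\<integral>\<^sup>+c. (\<Sum>k\<le>n. ennreal (w k) * indicator (S k) c) \<partial>\<sigma>)"
    by (rule nn_integral_mono_AE, use AE_graph in eventually_elim, rule pt, simp)
  also have "\<dots> = (\<Sum>k\<le>n. ennreal (w k) * emeasure \<sigma> (S k))"
    by (subst nn_integral_sum) (auto intro!: sum.cong nn_integral_cmult_indicator)
  also have "\<dots> \<le> (\<Sum>k\<le>n. ennreal ((8 * K\<^sup>2 * \<kappa>) powr s))"
  proof (rule sum_mono)
    fix k
    have "ennreal (w k) * emeasure \<sigma> (S k) \<le> ennreal (w k) * ennreal ((2 * K * (2 / 2 ^ k)) powr s)"
      unfolding S_def by (intro mult_left_mono emeasure_slab_le a) auto
    also have "\<dots> = ennreal (w k * (2 * K * (2 / 2 ^ k)) powr s)" by (simp add: ennreal_mult w_def)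
    also have "w k * (2 * K * (2 / 2 ^ k)) powr s = ((2 * K * (\<kappa> * 2 ^ k)) * (2 * K * (2 / 2 ^ k))) powr s"
      unfolding w_def using K_ge_2 \<kappa>0 by (intro powr_mult[symmetric])
    also have "(2 * K * (\<kappa> * 2 ^ k)) * (2 * K * (2 / 2 ^ k)) = 8 * K\<^sup>2 * \<kappa>"
      by (simp add: power2_eq_square)
    finally show "ennreal (w k) * emeasure \<sigma> (S k) \<le> ennreal ((8 * K\<^sup>2 * \<kappa>) powr s)" .
  qed
  also have "\<dots> = ennreal ((real n + 1) * (8 * K\<^sup>2 * \<kappa>) powr s)"
    by (subst sum_ennreal) (auto simp: algebra_simps)
  finally show ?thesis .
qed

text \<open>The kernel is cut off at distance \<open>r = (n + 1) 2\<^sup>-\<^sup>n\<close>, beyond which the Gaussian is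
  negligible. Within that distance, \<open>b\<close> lies in a ball of radius \<open>2 r\<close> once \<open>a\<close>, \<open>c\<close>, \<open>d\<close> are
  given, and the latter lie in the hyperbolic region of the previous lemma with \<open>\<kappa>\<close> comparable to
  \<open>r\<close>; this yields two factors \<open>r\<^sup>s\<close>. The powers of \<open>n + 1\<close> in them and the number of dyadic
  rectangles together are at most \<open>(n + 1)\<^sup>3\<close>.\<close>
lemma additive_energy_le:
  "(\<integral>\<^sup>+a. \<integral>\<^sup>+c. \<integral>\<^sup>+d. \<integral>\<^sup>+b. ennreal (gauss (2 ^ n) (a - c - d + b)) \<partial>\<sigma> \<partial>\<sigma> \<partial>\<sigma> \<partial>\<sigma>)
   \<le> ennreal (32 * K ^ 4 / lam * (real n + 1) ^ 3 * (2 ^ n) powr (- 2 * s) + 16 * K ^ 4 * (2 ^ n) powr (- 2 * s))"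
proof -
  interpret finite_measure \<sigma> by (rule finite_\<sigma>)
  define r where "r = (real n + 1) / 2 ^ n"
  define \<kappa> where "\<kappa> = K / lam * r"
  define E where "E = exp (- pi * (real n + 1)\<^sup>2)"
  define M where "M = 2 * K"
  have r: "r > 0" by (simp add: r_def)
  have M: "M \<ge> 0" "emeasure \<sigma> UNIV \<le> ennreal M" using K_ge_2 emeasure_UNIV_le by (auto simp: M_def)
  have E: "E \<ge> 0" by (simp add: E_def)
  have "1 \<le> K / lam" using K_ge_2 lam_pos lam_le_1 by (simp add: field_simps)
  hence "1 * ((real n + 1) / 2 ^ n) \<le> \<kappa>" unfolding \<kappa>_def r_def by (intro mult_right_mono) auto
  moreover have "1 / 2 ^ n \<le> (real n + 1) / 2 ^ n" by (intro divide_right_mono) auto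
  ultimately have \<kappa>: "1 / 2 ^ n \<le> \<kappa>" by simp
  define P where "P a c = {d :: real \<times> real. \<bar>fst a - fst c\<bar> * \<bar>fst a - fst d\<bar> \<le> \<kappa>}" for a c :: "real \<times> real"
  have Pm [measurable]: "P a c \<in> sets borel" for a c unfolding P_def by measurable
  define G where "G x = (\<bar>fst x\<bar> \<le> 1 \<and> x = (fst x, \<psi> (fst x)))" for x :: "real \<times> real"
  have AEG: "AE x in \<sigma>. G x" using AE_graph by (simp add: G_def)
  \<comment> \<open>\<open>I4\<close>, \<open>I3\<close>, \<open>I2\<close> integrate out \<open>b\<close>, \<open>d\<close> and \<open>c\<close>, in this order\<close>
  have I4: "(\<integral>\<^sup>+b. ennreal (gauss (2 ^ n) (a - c - d + b)) \<partial>\<sigma>)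
     \<le> ennreal ((2 * r) powr s) * indicator (P a c) d + ennreal (E * M)"
    if acd: "G a" "G c" "G d" for a c d
  proof -
    have "(\<integral>\<^sup>+b. ennreal (gauss (2 ^ n) (a - c - d + b)) \<partial>\<sigma>)
       \<le> (\<integral>\<^sup>+b. indicator (P a c) d * indicator (ball (c + d - a) (2 * r)) b + ennreal E \<partial>\<sigma>)"
    proof (rule nn_integral_mono_AE, use AEG in eventually_elim)
      fix b assume b: "G b"
      define x where "x = a - c - d + b"
      show "ennreal (gauss (2 ^ n) (a - c - d + b)) \<le> indicator (P a c) d * indicator (ball (c + d - a) (2 * r)) b + ennreal E"
        unfolding x_def[symmetric]
      proof (cases "norm x \<le> r")
        case True
        have "\<bar>fst x\<bar> \<le> r" "\<bar>snd x\<bar> \<le> r"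
          using True norm_fst_le[of "fst x" "snd x"] norm_snd_le[of "snd x" "fst x"] by simp_all
        moreover have "snd y = \<psi> (fst y)" if "G y" for y using that unfolding G_def by (metis snd_conv)
        ultimately have "\<bar>fst a - fst c\<bar> * \<bar>fst a - fst d\<bar> \<le> (1 + L) / lam * r"
          using acd b by (intro four_points_on_graph[of "fst a" "fst b"]) (auto simp: G_def x_def)
        hence "d \<in> P a c" by (simp add: P_def \<kappa>_def K_def)
        moreover have "b \<in> ball (c + d - a) (2 * r)"
        proof -
          have "dist (c + d - a) b = norm x" by (simp add: x_def dist_norm norm_minus_commute algebra_simps)
          thus ?thesis using True r by simp
        qed
        ultimately show "ennreal (gauss (2 ^ n) x) \<le> indicator (P a c) d * indicator (ball (c + d - a) (2 * r)) b + ennreal E"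
          using gauss_le_1[of "2 ^ n" x] by (simp add: add_increasing2 ennreal_le_1)
      next
        case False
        hence "real n + 1 \<le> 2 ^ n * norm x" by (simp add: r_def field_simps)
        hence "(real n + 1)\<^sup>2 \<le> (2 ^ n * norm x)\<^sup>2" by (intro power_mono) auto
        hence "gauss (2 ^ n) x \<le> E" by (simp add: gauss_def E_def)
        thus "ennreal (gauss (2 ^ n) x) \<le> indicator (P a c) d * indicator (ball (c + d - a) (2 * r)) b + ennreal E"
          by (intro add_increasing ennreal_leI) auto
      qed
    qed
    also have "\<dots> = (\<integral>\<^sup>+b. indicator (P a c) d * indicator (ball (c + d - a) (2 * r)) b \<partial>\<sigma>) + (\<integral>\<^sup>+b. ennreal E \<partial>\<sigma>)"
      by (rule nn_integral_add) (auto intro!: borel_measurable_times_ennreal borel_measurable_indicator)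
    also have "(\<integral>\<^sup>+b. indicator (P a c) d * indicator (ball (c + d - a) (2 * r)) b \<partial>\<sigma>)
       = indicator (P a c) d * emeasure \<sigma> (ball (c + d - a) (2 * r))"
      by (rule nn_integral_cmult_indicator) simp
    also have "(\<integral>\<^sup>+b. ennreal E \<partial>\<sigma>) = ennreal E * emeasure \<sigma> UNIV" by simp
    also have "indicator (P a c) d * emeasure \<sigma> (ball (c + d - a) (2 * r)) + ennreal E * emeasure \<sigma> UNIV
       \<le> indicator (P a c) d * ennreal ((2 * r) powr s) + ennreal E * ennreal M"
      using r M by (intro add_mono mult_left_mono emeasure_ball_le) auto
    finally show ?thesis using E M by (simp add: ennreal_mult mult.commute)
  qed
  have I3: "(\<integral>\<^sup>+d. \<integral>\<^sup>+b. ennreal (gauss (2 ^ n) (a - c - d + b)) \<partial>\<sigma> \<partial>\<sigma>)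
     \<le> ennreal ((2 * r) powr s) * emeasure \<sigma> (P a c) + ennreal (E * M * M)" if "G a" "G c" for a c
  proof -
    have "(\<integral>\<^sup>+d. \<integral>\<^sup>+b. ennreal (gauss (2 ^ n) (a - c - d + b)) \<partial>\<sigma> \<partial>\<sigma>)
       \<le> (\<integral>\<^sup>+d. ennreal ((2 * r) powr s) * indicator (P a c) d + ennreal (E * M) \<partial>\<sigma>)"
      by (rule nn_integral_mono_AE, use AEG in eventually_elim, rule I4) (use that in auto)
    also have "\<dots> = ennreal ((2 * r) powr s) * emeasure \<sigma> (P a c) + ennreal (E * M) * emeasure \<sigma> UNIV"
      by (subst nn_integral_add) (auto simp: nn_integral_cmult_indicator)
    also have "\<dots> \<le> ennreal ((2 * r) powr s) * emeasure \<sigma> (P a c) + ennreal (E * M) * ennreal M"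
      using M by (intro add_mono mult_left_mono) auto
    finally show ?thesis using E M by (simp add: ennreal_mult mult.assoc)
  qed
  define Q where "Q = (2 * r) powr s * ((real n + 1) * (8 * K\<^sup>2 * \<kappa>) powr s)"
  have Q: "Q \<ge> 0" by (simp add: Q_def)
  have Pm2: "(\<lambda>c. emeasure \<sigma> (P a c)) \<in> borel_measurable \<sigma>" for a
  proof -
    have "(\<lambda>c. \<integral>\<^sup>+d. indicator {z. \<bar>fst a - fst (fst z)\<bar> * \<bar>fst a - fst (snd z)\<bar> \<le> \<kappa>} (c, d) \<partial>\<sigma>) \<in> borel_measurable \<sigma>"
      by measurable
    also have "(\<lambda>c. \<integral>\<^sup>+d. indicator {z. \<bar>fst a - fst (fst z)\<bar> * \<bar>fst a - fst (snd z)\<bar> \<le> \<kappa>} (c, d) \<partial>\<sigma>) = (\<lambda>c. \<integral>\<^sup>+d. indicator (P a c) d \<partial>\<sigma>)"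
      by (intro ext nn_integral_cong) (auto simp: P_def split: split_indicator)
    finally show ?thesis by simp
  qed
  have I2: "(\<integral>\<^sup>+c. \<integral>\<^sup>+d. \<integral>\<^sup>+b. ennreal (gauss (2 ^ n) (a - c - d + b)) \<partial>\<sigma> \<partial>\<sigma> \<partial>\<sigma>)
     \<le> ennreal (Q + E * M * M * M)" if a: "G a" for a
  proof -
    have "(\<integral>\<^sup>+c. \<integral>\<^sup>+d. \<integral>\<^sup>+b. ennreal (gauss (2 ^ n) (a - c - d + b)) \<partial>\<sigma> \<partial>\<sigma> \<partial>\<sigma>)
       \<le> (\<integral>\<^sup>+c. ennreal ((2 * r) powr s) * emeasure \<sigma> (P a c) + ennreal (E * M * M) \<partial>\<sigma>)"
      by (rule nn_integral_mono_AE, use AEG in eventually_elim, rule I3) (use a in auto)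
    also have "\<dots> = ennreal ((2 * r) powr s) * (\<integral>\<^sup>+c. emeasure \<sigma> (P a c) \<partial>\<sigma>) + ennreal (E * M * M) * emeasure \<sigma> UNIV"
      using Pm2[of a] by (subst nn_integral_add) (auto simp: nn_integral_cmult)
    also have "\<dots> \<le> ennreal ((2 * r) powr s) * ennreal ((real n + 1) * (8 * K\<^sup>2 * \<kappa>) powr s) + ennreal (E * M * M) * ennreal M"
      using M a \<kappa> unfolding P_def by (intro add_mono mult_left_mono nn_integral_product_le) (auto simp: G_def)
    also have "\<dots> = ennreal (Q + E * M * M * M)"
      using E M by (simp add: Q_def ennreal_mult mult.assoc)
    finally show ?thesis .
  qed
  have "(\<integral>\<^sup>+a. \<integral>\<^sup>+c. \<integral>\<^sup>+d. \<integral>\<^sup>+b. ennreal (gauss (2 ^ n) (a - c - d + b)) \<partial>\<sigma> \<partial>\<sigma> \<partial>\<sigma> \<partial>\<sigma>)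
    \<le> (\<integral>\<^sup>+a. ennreal (Q + E * M * M * M) \<partial>\<sigma>)"
    by (rule nn_integral_mono_AE, use AEG in eventually_elim, rule I2)
  also have "\<dots> \<le> ennreal (Q + E * M * M * M) * ennreal M"
    using M by (auto intro!: mult_left_mono)
  also have "\<dots> = ennreal ((Q + E * M * M * M) * M)"
    using Q E M by (intro ennreal_mult[symmetric]) auto
  also have "\<dots> \<le> ennreal (32 * K ^ 4 / lam * (real n + 1) ^ 3 * (2 ^ n) powr (- 2 * s) + 16 * K ^ 4 * (2 ^ n) powr (- 2 * s))"
  proof (rule ennreal_leI)
    have K0: "K > 0" using K_ge_2 by simp
    have "Q = (real n + 1) * ((2 * r) * (8 * K\<^sup>2 * \<kappa>)) powr s"
    proof -
      have "((2 * r) * (8 * K\<^sup>2 * \<kappa>)) powr s = (2 * r) powr s * (8 * K\<^sup>2 * \<kappa>) powr s"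
        by (rule powr_mult)
      thus ?thesis by (simp only: Q_def mult_ac)
    qed
    also have "(2 * r) * (8 * K\<^sup>2 * \<kappa>) = (16 * K ^ 3 / lam) * ((real n + 1)\<^sup>2 * (1 / (2 ^ n)\<^sup>2))"
      by (simp add: \<kappa>_def r_def power2_eq_square power3_eq_cube field_simps)
    also have "\<dots> powr s = (16 * K ^ 3 / lam) powr s * (((real n + 1)\<^sup>2) powr s * (1 / (2 ^ n)\<^sup>2) powr s)"
      using K0 lam_pos by (simp only: powr_mult)
    also have "(1 / (2 ^ n)\<^sup>2) powr s = (2 ^ n) powr (- 2 * s)"
      by (simp add: powr_divide powr_minus_divide powr_powr[symmetric])
    finally have Qeq: "Q = (real n + 1) * ((16 * K ^ 3 / lam) powr s * (((real n + 1)\<^sup>2) powr s * (2 ^ n) powr (- 2 * s)))" .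
    have "1 * 1 \<le> 16 * K ^ 3" using K_ge_2 by (intro mult_mono one_le_power) auto
    hence "1 \<le> 16 * K ^ 3 / lam" using lam_le_1 lam_pos by (simp add: field_simps)
    hence "Q \<le> (real n + 1) * (16 * K ^ 3 / lam * ((real n + 1)\<^sup>2 * (2 ^ n) powr (- 2 * s)))"
      unfolding Qeq using K0 lam_pos by (intro mult_left_mono mult_mono powr_s_le order_refl) auto
    hence "Q * M \<le> (real n + 1) * (16 * K ^ 3 / lam * ((real n + 1)\<^sup>2 * (2 ^ n) powr (- 2 * s))) * M"
      using M by (intro mult_right_mono)
    also have "\<dots> = 32 * K ^ 4 / lam * (real n + 1) ^ 3 * (2 ^ n) powr (- 2 * s)"
      by (simp add: M_def power2_eq_square power3_eq_cube power4_eq_xxxx mult_ac)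
    finally have q: "Q * M \<le> 32 * K ^ 4 / lam * (real n + 1) ^ 3 * (2 ^ n) powr (- 2 * s)" .
    have "E \<le> (2 ^ n) powr (- 2 * s)"
    proof -
      have "2 * s * (real n * ln 2) \<le> 2 * 1 * (real n * 1)"
        using s_le s_ge ln_le_minus_one[of 2] by (intro mult_mono) auto
      also have "\<dots> \<le> 3 * (real n + 1)\<^sup>2" by (simp add: power2_eq_square algebra_simps)
      also have "\<dots> \<le> pi * (real n + 1)\<^sup>2" using pi_gt3 by (intro mult_right_mono) auto
      finally show ?thesis by (simp add: E_def powr_def ln_realpow mult.assoc)
    qed
    hence "E * (16 * K ^ 4) \<le> (2 ^ n) powr (- 2 * s) * (16 * K ^ 4)" using K0 by (intro mult_right_mono) auto
    moreover have "M * M * M * M = 16 * K ^ 4" by (simp add: M_def power4_eq_xxxx)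
    hence "(Q + E * M * M * M) * M = Q * M + E * (16 * K ^ 4)" by (simp only: distrib_right mult.assoc)
    ultimately show "(Q + E * M * M * M) * M \<le> 32 * K ^ 4 / lam * (real n + 1) ^ 3 * (2 ^ n) powr (- 2 * s) + 16 * K ^ 4 * (2 ^ n) powr (- 2 * s)"
      using q by (simp only: mult.commute[of "(2 ^ n) powr (- 2 * s)"] add_mono)
  qed
  finally show ?thesis .
qed

end

section \<open>The self-improving inequality for the sixth moment\<close>

text \<open>The Gaussian weight takes the place of a dyadic decomposition into annuli: the annulus
  \<open>2\<^sup>k\<^sup>-\<^sup>1 < norm \<xi> \<le> 2\<^sup>k\<close> lies in the bulk of the \<open>k\<close>-th weight, and the tail beyond \<open>2\<^sup>n\<close> is
  absorbed by the last weight itself.\<close>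
lemma gaussian_weight_le_dyadic_sum:
  "gauss (1 / 2 ^ n) \<xi> / sqrt (max 1 (norm \<xi>)) \<le> (\<Sum>k\<le>n. sqrt 2 * exp pi * (2 ^ k) powr (- 1 / 2) * gauss (1 / 2 ^ k) \<xi>)"
    (is "?l \<le> (\<Sum>k\<le>n. ?t k)")
proof -
  define N where "N = norm \<xi>"
  have mem: "?t k \<le> (\<Sum>k\<le>n. ?t k)" if "k \<le> n" for k
    using that by (intro member_le_sum) (auto simp: less_imp_le gauss_pos)
  have gl: "exp (- pi) \<le> gauss (1 / 2 ^ k) \<xi>" if "N \<le> 2 ^ k" for k
  proof -
    have "(1 / 2 ^ k * N)\<^sup>2 \<le> 1" using that by (intro power_le_one) (auto simp: N_def)
    thus ?thesis by (simp add: gauss_def N_def)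
  qed
  have big: "sqrt 2 * (2 ^ k) powr (- 1 / 2) \<le> ?t k" if "N \<le> 2 ^ k" for k
  proof -
    have "sqrt 2 * (2 ^ k) powr (- 1 / 2) * (exp pi * exp (- pi)) \<le> sqrt 2 * (2 ^ k) powr (- 1 / 2) * (exp pi * gauss (1 / 2 ^ k) \<xi>)"
      using gl[OF that] by (intro mult_left_mono) auto
    thus ?thesis by (simp add: exp_minus mult_ac)
  qed
  have sq: "sqrt 2 * (2 ^ k) powr (- 1 / 2) = 1 / sqrt (2 ^ k / 2)" for k
    by (simp add: powr_minus powr_half_sqrt real_sqrt_divide field_simps)
  show ?thesis
  proof (cases "N \<le> 1")
    case True
    have "?l \<le> 1" using True gauss_le_1[of "1 / 2 ^ n" \<xi>] by (simp add: N_def)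
    also have "1 \<le> sqrt 2 * (2 ^ 0) powr (- 1 / 2)" by simp
    also have "\<dots> \<le> ?t 0" using True by (intro big) simp
    also have "\<dots> \<le> (\<Sum>k\<le>n. ?t k)" by (rule mem) simp
    finally show ?thesis .
  next
    case False
    have l: "?l = gauss (1 / 2 ^ n) \<xi> / sqrt N" using False by (simp add: N_def)
    show ?thesis
    proof (cases "N \<le> 2 ^ n")
      case True
      define k where "k = (LEAST k. N \<le> 2 ^ k)"
      have k: "N \<le> 2 ^ k" "k \<le> n" unfolding k_def using True by (auto intro: LeastI Least_le)
      have "k \<noteq> 0" using k False by (intro notI) simp
      then obtain j where j: "k = Suc j" by (cases k) auto
      have "\<not> N \<le> 2 ^ j" using not_less_Least[of j "\<lambda>k. N \<le> 2 ^ k"] j unfolding k_def by simp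
      hence N: "2 ^ k / 2 \<le> N" by (simp add: j)
      have "?l \<le> 1 / sqrt N" unfolding l using False gauss_le_1[of "1 / 2 ^ n" \<xi>] by (intro divide_right_mono) auto
      also have "\<dots> \<le> 1 / sqrt (2 ^ k / 2)" using N by (intro divide_left_mono real_sqrt_le_mono) (use False in auto)
      also have "\<dots> \<le> ?t k" unfolding sq[symmetric] by (rule big[OF k(1)])
      also have "\<dots> \<le> (\<Sum>k\<le>n. ?t k)" by (rule mem[OF k(2)])
      finally show ?thesis .
    next
      case F: False
      have "1 \<le> sqrt 2 * exp pi" using mult_mono[of 1 "sqrt 2" 1 "exp pi"] by simp
      have "?l \<le> gauss (1 / 2 ^ n) \<xi> / sqrt (2 ^ n)" unfolding l using F False gauss_pos[of "1 / 2 ^ n" \<xi>]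
        by (intro divide_left_mono) auto
      also have "\<dots> = 1 * ((2 ^ n) powr (- 1 / 2) * gauss (1 / 2 ^ n) \<xi>)"
        by (simp add: powr_minus powr_half_sqrt field_simps)
      also have "\<dots> \<le> (sqrt 2 * exp pi) * ((2 ^ n) powr (- 1 / 2) * gauss (1 / 2 ^ n) \<xi>)"
        using \<open>1 \<le> sqrt 2 * exp pi\<close> gauss_pos[of "1 / 2 ^ n" \<xi>] by (intro mult_right_mono) auto
      also have "\<dots> = ?t n" by (simp only: mult.assoc)
      also have "\<dots> \<le> (\<Sum>k\<le>n. ?t k)" by (rule mem) simp
      finally show ?thesis .
    qed
  qed
qed

text \<open>The maximum \<open>m\<close> of \<open>f\<close> over \<open>{..n}\<close> satisfies \<open>m \<le> q * sqrt m\<close>, hence \<open>m \<le> q\<^sup>2\<close>.\<close>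
lemma sqrt_recursion_bound:
  fixes f :: "nat \<Rightarrow> real"
  assumes f: "\<And>n. f n \<ge> 0" and A: "A \<ge> 0" and C: "C \<ge> 0"
    and rec: "\<And>n. f n \<le> A * (\<Sum>k\<le>n. sqrt (C * (real k + 1) ^ 3) * sqrt (f k))"
  shows "f n \<le> A\<^sup>2 * C * (real n + 1) ^ 5"
proof -
  define m where "m = Max (f ` {..n})"
  have "m \<in> f ` {..n}" unfolding m_def by (intro Max_in) auto
  then obtain j where j: "j \<le> n" "m = f j" by auto
  have fm: "f k \<le> m" if "k \<le> n" for k unfolding m_def using that by (intro Max_ge) auto
  have m0: "m \<ge> 0" using f j by simp
  define q where "q = A * ((real n + 1) * sqrt (C * (real n + 1) ^ 3))"
  have "m \<le> A * (\<Sum>k\<le>j. sqrt (C * (real k + 1) ^ 3) * sqrt (f k))" unfolding j(2) by (rule rec)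
  also have "\<dots> \<le> A * (\<Sum>k\<le>j. sqrt (C * (real n + 1) ^ 3) * sqrt m)"
    using j(1) A C f fm
    by (intro mult_left_mono sum_mono mult_mono real_sqrt_le_mono power_mono) auto
  also have "\<dots> = A * ((real j + 1) * (sqrt (C * (real n + 1) ^ 3) * sqrt m))" by simp
  also have "\<dots> \<le> A * ((real n + 1) * (sqrt (C * (real n + 1) ^ 3) * sqrt m))"
    using j(1) A C m0 by (intro mult_left_mono mult_right_mono) auto
  finally have "sqrt m * sqrt m \<le> q * sqrt m" using m0 by (simp add: q_def mult.assoc)
  hence "sqrt m \<le> q"
  proof (cases "m = 0")
    case True
    thus ?thesis using A C by (simp add: q_def)
  next
    case False
    hence "0 < sqrt m" using m0 by simp
    with \<open>sqrt m * sqrt m \<le> q * sqrt m\<close> show ?thesis by (rule mult_right_le_imp_le)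
  qed
  hence "(sqrt m)\<^sup>2 \<le> q\<^sup>2" using m0 by (intro power_mono) auto
  hence "m \<le> q\<^sup>2" using m0 by simp
  also have "q\<^sup>2 = A\<^sup>2 * C * (real n + 1) ^ 5"
    using C by (simp add: q_def power_mult_distrib power2_eq_square eval_nat_numeral mult_ac)
  finally show ?thesis using fm[of n] by simp
qed

text \<open>Take the fifth root: \<open>2\<^sup>n\<^sup>\<epsilon>\<^sup>/\<^sup>5 \<ge> 1 + n \<epsilon> / 10\<close>, because \<open>ln 2 \<ge> 1/2\<close>.\<close>
lemma polynomial_le_exponential:
  assumes "0 < \<epsilon>" "\<epsilon> < 1"
  shows "(real n + 1) ^ 5 \<le> (10 / \<epsilon>) ^ 5 * (2 ^ n) powr \<epsilon>"
proof -
  define x where "x = real n * \<epsilon> / 5"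
  have "ln 2 \<ge> (1/2::real)" using ln2_ge_two_thirds by simp
  hence "x * (1 / 2) \<le> x * ln 2" using assms by (intro mult_left_mono) (auto simp: x_def)
  moreover have "1 + x * ln 2 \<le> exp (x * ln 2)" by (rule exp_ge_add_one_self)
  ultimately have "1 + x / 2 \<le> exp (x * ln 2)" by linarith
  hence "1 + x / 2 \<le> 2 powr x" by (simp add: powr_def)
  moreover have "(real n + 1) * (\<epsilon> / 10) \<le> 1 + x / 2" using assms by (simp add: x_def field_simps)
  ultimately have "(real n + 1) * (\<epsilon> / 10) \<le> 2 powr x" by simp
  hence "real n + 1 \<le> 10 / \<epsilon> * 2 powr x" using assms by (simp add: field_simps)
  hence "(real n + 1) ^ 5 \<le> (10 / \<epsilon> * 2 powr x) ^ 5" by (intro power_mono) auto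
  also have "\<dots> = (10 / \<epsilon>) ^ 5 * (2 ^ n) powr \<epsilon>"
  proof -
    have "(2 powr x) ^ 5 = 2 powr (real n * \<epsilon>)" by (simp add: powr_power x_def)
    moreover have "(2 ^ n) powr \<epsilon> = 2 powr (real n * \<epsilon>)" by (simp add: powr_powr flip: powr_realpow)
    ultimately show ?thesis by (simp only: power_mult_distrib)
  qed
  finally show ?thesis .
qed

context frostman_on_graph
begin

definition moment :: "nat \<Rightarrow> real \<Rightarrow> real" where
  "moment p R = (\<integral>\<xi>. gauss (1 / R) \<xi> * norm (fourier_measure \<sigma> \<xi>) ^ p \<partial>lborel)"

lemma measurable_fourier_\<sigma> [measurable]: "fourier_measure \<sigma> \<in> borel_measurable borel"
  by (rule measurable_fourier_measure[OF finite_\<sigma> sets_\<sigma>])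

lemma integrable_moment_weighted:
  assumes R: "R > 0" and [measurable]: "h \<in> borel_measurable borel"
    and h: "\<And>\<xi>. 0 \<le> h \<xi>" "\<And>\<xi>. h \<xi> \<le> 1"
  shows "integrable lborel (\<lambda>\<xi>. gauss (1 / R) \<xi> * norm (fourier_measure \<sigma> \<xi>) ^ p * h \<xi>)"
proof (rule Bochner_Integration.integrable_bound)
  show "integrable lborel (\<lambda>\<xi>. gauss (1 / R) \<xi> * measure \<sigma> UNIV ^ p)"
    using integrable_gauss[OF R] by simp
  show "AE \<xi> in lborel. norm (gauss (1 / R) \<xi> * norm (fourier_measure \<sigma> \<xi>) ^ p * h \<xi>) \<le> norm (gauss (1 / R) \<xi> * measure \<sigma> UNIV ^ p)"
  proof (rule AE_I2)
    fix \<xi>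
    have "gauss (1 / R) \<xi> * norm (fourier_measure \<sigma> \<xi>) ^ p * h \<xi> \<le> gauss (1 / R) \<xi> * measure \<sigma> UNIV ^ p * 1"
      using h norm_fourier_measure_le[OF finite_\<sigma> sets_\<sigma>, of \<xi>] gauss_pos[of "1 / R" \<xi>]
      by (intro mult_mono power_mono) auto
    thus "norm (gauss (1 / R) \<xi> * norm (fourier_measure \<sigma> \<xi>) ^ p * h \<xi>) \<le> norm (gauss (1 / R) \<xi> * measure \<sigma> UNIV ^ p)"
      using h gauss_pos[of "1 / R" \<xi>] by (simp add: abs_mult)
  qed
qed measurable

lemma integrable_moment:
  "R > 0 \<Longrightarrow> integrable lborel (\<lambda>\<xi>. gauss (1 / R) \<xi> * norm (fourier_measure \<sigma> \<xi>) ^ p)"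
  using integrable_moment_weighted[of R "\<lambda>_. 1" p] by simp

lemma moment_nonneg: "0 \<le> moment p R"
  unfolding moment_def by (intro integral_nonneg_AE) (auto intro!: mult_nonneg_nonneg simp: gauss_pos less_imp_le)

text \<open>In the applications \<open>\<mu>\<close> is a convolution of copies of \<open>\<sigma>\<close> and of its reflection, equally many
  of each.\<close>
lemma moment_eq_nn_integral:
  assumes R: "R > 0" and fin: "finite_measure \<mu>" and sets [measurable_cong]: "sets \<mu> = sets borel"
    and four: "\<And>\<xi>. fourier_measure \<mu> \<xi> = of_real (norm (fourier_measure \<sigma> \<xi>) ^ p)"
  shows "ennreal (moment p R) = ennreal (R\<^sup>2) * (\<integral>\<^sup>+x. ennreal (gauss R x) \<partial>\<mu>)"
proof -
  interpret finite_measure \<mu> by fact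
  have "complex_of_real (moment p R) = (\<integral>\<xi>. of_real (gauss (1 / R) \<xi>) * fourier_measure \<mu> \<xi> \<partial>lborel)"
    unfolding moment_def four integral_complex_of_real[symmetric] by simp
  also have "\<dots> = of_real (R\<^sup>2 * (\<integral>x. gauss R x \<partial>\<mu>))" by (rule fourier_gauss_measure[OF R fin sets])
  finally have "moment p R = R\<^sup>2 * (\<integral>x. gauss R x \<partial>\<mu>)" by (simp only: of_real_eq_iff)
  moreover have "integrable \<mu> (gauss R)"
    by (rule integrable_const_bound[where B = 1]) (auto simp: gauss_le_1 gauss_pos less_imp_le)
  hence "(\<integral>\<^sup>+x. ennreal (gauss R x) \<partial>\<mu>) = ennreal (\<integral>x. gauss R x \<partial>\<mu>)"
    by (intro nn_integral_eq_integral) (auto simp: gauss_pos less_imp_le)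
  ultimately show ?thesis by (simp add: ennreal_mult')
qed

definition \<tau> where "\<tau> = reflection \<sigma>"

lemma \<tau>_simps [simp]: "sets \<tau> = sets borel" "finite_measure \<tau>"
    "fourier_measure \<tau> \<xi> = cnj (fourier_measure \<sigma> \<xi>)"
  unfolding \<tau>_def by (auto intro: finite_measure_reflection finite_\<sigma> fourier_measure_reflection)

lemmas measurable_cong_\<tau> [measurable_cong] = \<tau>_simps(1)

lemma moment_4_le:
  "moment 4 (2 ^ n) \<le> 48 * K ^ 4 / lam * (real n + 1) ^ 3 * (2 ^ n) powr (2 - 2 * s)"
proof -
  interpret finite_measure \<sigma> by (rule finite_\<sigma>)
  interpret T: finite_measure \<tau> by simp
  note [simp] = finite_\<sigma> convolution_finite
  define \<mu> where "\<mu> = (\<sigma> \<star> (\<tau> \<star> (\<tau> \<star> \<sigma>)))"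
  define R :: real where "R = 2 ^ n"
  have R: "R \<ge> 1" by (simp add: R_def)
  have K0: "K > 0" using K_ge_2 by simp
  have "fourier_measure \<mu> \<xi> = of_real (norm (fourier_measure \<sigma> \<xi>) ^ 4)" for \<xi>
  proof -
    have "fourier_measure \<mu> \<xi> = (fourier_measure \<sigma> \<xi> * cnj (fourier_measure \<sigma> \<xi>)) ^ 2"
      by (simp add: \<mu>_def fourier_measure_convolution power2_eq_square mult_ac)
    also have "\<dots> = of_real ((norm (fourier_measure \<sigma> \<xi>))\<^sup>2) ^ 2" by (simp only: complex_norm_square)
    finally show ?thesis by (simp flip: power_mult)
  qed
  hence "ennreal (moment 4 R) = ennreal (R\<^sup>2) * (\<integral>\<^sup>+x. ennreal (gauss R x) \<partial>\<mu>)"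
    using R by (intro moment_eq_nn_integral) (simp_all add: \<mu>_def)
  also have "(\<integral>\<^sup>+x. ennreal (gauss R x) \<partial>\<mu>)
     = (\<integral>\<^sup>+a. \<integral>\<^sup>+c. \<integral>\<^sup>+d. \<integral>\<^sup>+b. ennreal (gauss R (a - c - d + b)) \<partial>\<sigma> \<partial>\<sigma> \<partial>\<sigma> \<partial>\<sigma>)"
  proof -
    have 1: "(\<integral>\<^sup>+y. ennreal (gauss R (e + y)) \<partial>(\<tau> \<star> \<sigma>)) = (\<integral>\<^sup>+d. \<integral>\<^sup>+b. ennreal (gauss R (e - d + b)) \<partial>\<sigma> \<partial>\<sigma>)" for e
      unfolding \<tau>_def using finite_measure_reflection[OF finite_\<sigma> sets_\<sigma>]
      by (subst nn_integral_convolution) (simp_all add: nn_integral_reflection add.assoc[symmetric])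
    have 2: "(\<integral>\<^sup>+y. ennreal (gauss R (a + y)) \<partial>(\<tau> \<star> (\<tau> \<star> \<sigma>))) = (\<integral>\<^sup>+c. \<integral>\<^sup>+d. \<integral>\<^sup>+b. ennreal (gauss R (a - c - d + b)) \<partial>\<sigma> \<partial>\<sigma> \<partial>\<sigma>)" for a
    proof -
      have "(\<integral>\<^sup>+y. ennreal (gauss R (a + y)) \<partial>(\<tau> \<star> (\<tau> \<star> \<sigma>))) = (\<integral>\<^sup>+c. \<integral>\<^sup>+y. ennreal (gauss R (a + c + y)) \<partial>(\<tau> \<star> \<sigma>) \<partial>\<tau>)"
        by (subst nn_integral_convolution) (simp_all add: add.assoc)
      also have "\<dots> = (\<integral>\<^sup>+c. \<integral>\<^sup>+d. \<integral>\<^sup>+b. ennreal (gauss R (a + c - d + b)) \<partial>\<sigma> \<partial>\<sigma> \<partial>\<tau>)" by (simp only: 1)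
      also have "\<dots> = (\<integral>\<^sup>+c. \<integral>\<^sup>+d. \<integral>\<^sup>+b. ennreal (gauss R (a + (- c) - d + b)) \<partial>\<sigma> \<partial>\<sigma> \<partial>\<sigma>)"
        unfolding \<tau>_def by (rule nn_integral_reflection[OF sets_\<sigma>]) measurable
      finally show ?thesis by simp
    qed
    show ?thesis unfolding \<mu>_def
      by (subst nn_integral_convolution) (simp_all add: 2)
  qed
  also have "\<dots> \<le> ennreal (32 * K ^ 4 / lam * (real n + 1) ^ 3 * R powr (- 2 * s) + 16 * K ^ 4 * R powr (- 2 * s))"
    unfolding R_def by (rule additive_energy_le)
  also have "ennreal (R\<^sup>2) * \<dots> = ennreal (R\<^sup>2 * (32 * K ^ 4 / lam * (real n + 1) ^ 3 * R powr (- 2 * s) + 16 * K ^ 4 * R powr (- 2 * s)))"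
    using K0 lam_pos by (intro ennreal_mult[symmetric]) auto
  also have "R\<^sup>2 * (32 * K ^ 4 / lam * (real n + 1) ^ 3 * R powr (- 2 * s) + 16 * K ^ 4 * R powr (- 2 * s))
     = (32 * K ^ 4 / lam * (real n + 1) ^ 3 + 16 * K ^ 4) * (R powr 2 * R powr (- 2 * s))"
    using R by (simp add: algebra_simps)
  also have "R powr 2 * R powr (- 2 * s) = R powr (2 - 2 * s)" by (simp flip: powr_add)
  finally have "ennreal (moment 4 R) \<le> ennreal ((32 * K ^ 4 / lam * (real n + 1) ^ 3 + 16 * K ^ 4) * R powr (2 - 2 * s))"
    by (simp add: mult_left_mono)
  hence "moment 4 R \<le> (32 * K ^ 4 / lam * (real n + 1) ^ 3 + 16 * K ^ 4) * R powr (2 - 2 * s)"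
    using K0 lam_pos by (subst (asm) ennreal_le_iff) auto
  also have "\<dots> \<le> (48 * K ^ 4 / lam * (real n + 1) ^ 3) * R powr (2 - 2 * s)"
  proof (rule mult_right_mono)
    have "16 * K ^ 4 * 1 \<le> (16 * K ^ 4 / lam) * (real n + 1) ^ 3"
      using K0 lam_pos lam_le_1 by (intro mult_mono) (auto simp: field_simps)
    thus "32 * K ^ 4 / lam * (real n + 1) ^ 3 + 16 * K ^ 4 \<le> 48 * K ^ 4 / lam * (real n + 1) ^ 3" by simp
  qed simp
  finally show ?thesis by (simp add: R_def)
qed

definition mixed_moment :: "real \<Rightarrow> real" where
  "mixed_moment R = (\<integral>\<xi>. gauss (1 / R) \<xi> * norm (fourier_measure \<sigma> \<xi>) ^ 5 * (1 / sqrt (max 1 (norm \<xi>))) \<partial>lborel)"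

lemma integrable_mixed:
  "R > 0 \<Longrightarrow> integrable lborel (\<lambda>\<xi>. gauss (1 / R) \<xi> * norm (fourier_measure \<sigma> \<xi>) ^ 5 * (1 / sqrt (max 1 (norm \<xi>))))"
  by (intro integrable_moment_weighted) auto

text \<open>Write the sixth moment as an integral against \<open>\<nu> \<star> \<sigma>\<close>, where the Fourier transform of \<open>\<nu>\<close> is
  that of \<open>\<sigma>\<close>, conjugated, times its modulus to the fourth power. Domination replaces the single
  last factor \<open>\<sigma>\<close> by the uniform measure on the graph, at the price of \<open>R\<^sup>1\<^sup>-\<^sup>s\<close>, and back on the
  frequency side that factor contributes its decay.\<close>
lemma moment_6_le_mixed:
  assumes R: "R \<ge> 1"
  shows "moment 6 R \<le> 4 * exp pi * K * D * R powr (1 - s) * mixed_moment R"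
proof -
  interpret finite_measure \<sigma> by (rule finite_\<sigma>)
  note [simp] = finite_\<sigma> convolution_finite finite_graph_measure
  let ?F = "fourier_measure \<sigma>" and ?\<gamma> = "graph_measure \<psi>"
  define \<nu> where "\<nu> = (\<sigma> \<star> (\<tau> \<star> (\<sigma> \<star> (\<tau> \<star> \<tau>))))"
  have \<nu> [simp, measurable_cong]: "sets \<nu> = sets borel" by (simp add: \<nu>_def)
  have \<nu>f [simp]: "finite_measure \<nu>" by (simp add: \<nu>_def)
  interpret N: finite_measure \<nu> by simp
  interpret G: finite_measure ?\<gamma> by simp
  have F\<nu>: "fourier_measure \<nu> \<xi> = (?F \<xi> * cnj (?F \<xi>))\<^sup>2 * cnj (?F \<xi>)" for \<xi>
    by (simp add: \<nu>_def fourier_measure_convolution power2_eq_square mult_ac)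
  have n\<nu>: "norm (fourier_measure \<nu> \<xi>) = norm (?F \<xi>) ^ 5" for \<xi>
    unfolding F\<nu> by (simp add: norm_mult norm_power power2_eq_square eval_nat_numeral)
  have six: "fourier_measure (\<nu> \<star> \<sigma>) \<xi> = of_real (norm (?F \<xi>) ^ 6)" for \<xi>
  proof -
    have "fourier_measure (\<nu> \<star> \<sigma>) \<xi> = (?F \<xi> * cnj (?F \<xi>)) ^ 3"
      by (simp add: fourier_measure_convolution F\<nu> power2_eq_square power3_eq_cube mult_ac)
    also have "\<dots> = of_real ((norm (?F \<xi>))\<^sup>2) ^ 3" by (simp only: complex_norm_square)
    finally show ?thesis by (simp flip: power_mult)
  qed
  define Q where "Q = R / sqrt 2"
  have Q: "Q > 0" "R\<^sup>2 = 2 * Q\<^sup>2" "Q \<le> R" using R by (auto simp: Q_def power_divide field_simps)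
  define c where "c = 2 * exp pi * K * R powr (1 - s)"
  have c: "c \<ge> 0" using K_ge_2 by (simp add: c_def)
  define X where "X = (\<integral>x. gauss Q x \<partial>(\<nu> \<star> ?\<gamma>))"
  have X0: "X \<ge> 0" unfolding X_def by (intro integral_nonneg_AE) (auto simp: gauss_pos less_imp_le)
  have "ennreal (moment 6 R) = ennreal (R\<^sup>2) * (\<integral>\<^sup>+x. ennreal (gauss R x) \<partial>(\<nu> \<star> \<sigma>))"
    using R by (intro moment_eq_nn_integral six) simp_all
  also have "(\<integral>\<^sup>+x. ennreal (gauss R x) \<partial>(\<nu> \<star> \<sigma>)) = (\<integral>\<^sup>+z. \<integral>\<^sup>+x. ennreal (gauss R (z + x)) \<partial>\<sigma> \<partial>\<nu>)"
    by (rule nn_integral_convolution) simp_all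
  also have "\<dots> \<le> (\<integral>\<^sup>+z. ennreal c * (\<integral>\<^sup>+y. ennreal (gauss Q (z + y)) \<partial>?\<gamma>) \<partial>\<nu>)"
    unfolding c_def Q_def by (intro nn_integral_mono gaussian_domination R)
  also have "\<dots> = ennreal c * (\<integral>\<^sup>+z. (\<integral>\<^sup>+y. ennreal (gauss Q (z + y)) \<partial>?\<gamma>) \<partial>\<nu>)"
    by (rule nn_integral_cmult) measurable
  also have "(\<integral>\<^sup>+z. (\<integral>\<^sup>+y. ennreal (gauss Q (z + y)) \<partial>?\<gamma>) \<partial>\<nu>) = (\<integral>\<^sup>+x. ennreal (gauss Q x) \<partial>(\<nu> \<star> ?\<gamma>))"
    by (rule nn_integral_convolution[symmetric]) simp_all
  also have "\<dots> = ennreal X"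
  proof -
    interpret C: finite_measure "\<nu> \<star> ?\<gamma>" by simp
    have "integrable (\<nu> \<star> ?\<gamma>) (gauss Q)"
      by (rule C.integrable_const_bound[where B = 1]) (auto simp: gauss_le_1 gauss_pos less_imp_le)
    thus ?thesis unfolding X_def by (intro nn_integral_eq_integral) (auto simp: gauss_pos less_imp_le)
  qed
  also have "ennreal (R\<^sup>2) * (ennreal c * ennreal X) = ennreal (R\<^sup>2 * (c * X))"
    using c X0 by (simp add: ennreal_mult)
  finally have "ennreal (moment 6 R) \<le> ennreal (R\<^sup>2 * (c * X))" by (simp add: mult_left_mono)
  hence 1: "moment 6 R \<le> 2 * c * (Q\<^sup>2 * X)"
    using c X0 Q by (subst (asm) ennreal_le_iff) (auto simp: mult_ac)
  have "complex_of_real (Q\<^sup>2 * X) = (\<integral>\<xi>. of_real (gauss (1 / Q) \<xi>) * fourier_measure (\<nu> \<star> ?\<gamma>) \<xi> \<partial>lborel)"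
    unfolding X_def using Q by (intro fourier_gauss_measure[symmetric]) simp_all
  hence "Q\<^sup>2 * X = norm (\<integral>\<xi>. of_real (gauss (1 / Q) \<xi>) * fourier_measure (\<nu> \<star> ?\<gamma>) \<xi> \<partial>lborel)"
    using X0 by (metis norm_of_real abs_of_nonneg mult_nonneg_nonneg zero_le_power2)
  also have "\<dots> \<le> (\<integral>\<xi>. D * (gauss (1 / R) \<xi> * norm (?F \<xi>) ^ 5 * (1 / sqrt (max 1 (norm \<xi>)))) \<partial>lborel)"
  proof (rule Bochner_Integration.integral_norm_bound_integral)
    have le: "norm (of_real (gauss (1 / Q) \<xi>) * fourier_measure (\<nu> \<star> ?\<gamma>) \<xi>)
       \<le> D * (gauss (1 / R) \<xi> * norm (?F \<xi>) ^ 5 * (1 / sqrt (max 1 (norm \<xi>))))" for \<xi>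
    proof -
      have "(1 / R * norm \<xi>)\<^sup>2 \<le> (1 / Q * norm \<xi>)\<^sup>2" using Q R by (intro power_mono mult_right_mono divide_left_mono) auto
      hence "gauss (1 / Q) \<xi> \<le> gauss (1 / R) \<xi>" by (simp add: gauss_def)
      hence "gauss (1 / Q) \<xi> * (norm (?F \<xi>) ^ 5 * norm (fourier_measure ?\<gamma> \<xi>)) \<le> gauss (1 / R) \<xi> * (norm (?F \<xi>) ^ 5 * (D / sqrt (max 1 (norm \<xi>))))"
        by (intro mult_mono decay order_refl) (auto simp: gauss_pos less_imp_le)
      thus ?thesis by (simp add: fourier_measure_convolution norm_mult n\<nu> gauss_pos less_imp_le mult_ac)
    qed
    show ib: "integrable lborel (\<lambda>\<xi>. D * (gauss (1 / R) \<xi> * norm (?F \<xi>) ^ 5 * (1 / sqrt (max 1 (norm \<xi>)))))"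
      using R by (intro integrable_mult_right integrable_mixed) auto
    have [measurable]: "fourier_measure (\<nu> \<star> ?\<gamma>) \<in> borel_measurable borel"
      by (rule measurable_fourier_measure) simp_all
    show "integrable lborel (\<lambda>\<xi>. of_real (gauss (1 / Q) \<xi>) * fourier_measure (\<nu> \<star> ?\<gamma>) \<xi>)"
      by (rule Bochner_Integration.integrable_bound[OF ib], measurable) (rule AE_I2, rule order_trans[OF le], simp only: real_norm_def abs_ge_self)
    show "norm (of_real (gauss (1 / Q) \<xi>) * fourier_measure (\<nu> \<star> ?\<gamma>) \<xi>)
       \<le> D * (gauss (1 / R) \<xi> * norm (?F \<xi>) ^ 5 * (1 / sqrt (max 1 (norm \<xi>))))" for \<xi> by (rule le)
  qed
  also have "\<dots> = D * mixed_moment R" unfolding mixed_moment_def by (rule integral_mult_right_zero)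
  finally have "2 * c * (Q\<^sup>2 * X) \<le> 2 * c * (D * mixed_moment R)" using c by (intro mult_left_mono) auto
  with 1 show ?thesis by (simp add: c_def mult_ac)
qed

text \<open>Cauchy--Schwarz, with the fifth power split as \<open>2 + 3\<close>.\<close>
lemma moment_5_le: "R > 0 \<Longrightarrow> moment 5 R \<le> sqrt (moment 4 R) * sqrt (moment 6 R)"
proof -
  assume R: "R > 0"
  let ?F = "fourier_measure \<sigma>"
  define f where "f \<xi> = sqrt (gauss (1 / R) \<xi>) * norm (?F \<xi>) ^ 2" for \<xi>
  define g where "g \<xi> = sqrt (gauss (1 / R) \<xi>) * norm (?F \<xi>) ^ 3" for \<xi>
  have m [measurable]: "f \<in> borel_measurable borel" "g \<in> borel_measurable borel" unfolding f_def g_def by measurable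
  have nn: "0 \<le> f \<xi>" "0 \<le> g \<xi>" for \<xi> by (auto simp: f_def g_def gauss_pos less_imp_le)
  have conv: "(\<integral>\<^sup>+\<xi>. ennreal (gauss (1 / R) \<xi> * norm (?F \<xi>) ^ p) \<partial>lborel) = ennreal (moment p R)" for p
    unfolding moment_def using integrable_moment[OF R]
    by (intro nn_integral_eq_integral) (auto simp: gauss_pos less_imp_le)
  have sq: "sqrt (gauss (1 / R) \<xi>) * sqrt (gauss (1 / R) \<xi>) = gauss (1 / R) \<xi>" for \<xi>
    by (simp add: gauss_pos less_imp_le)
  have e: "f \<xi> * g \<xi> = gauss (1 / R) \<xi> * norm (?F \<xi>) ^ 5" "(f \<xi>)\<^sup>2 = gauss (1 / R) \<xi> * norm (?F \<xi>) ^ 4"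
     "(g \<xi>)\<^sup>2 = gauss (1 / R) \<xi> * norm (?F \<xi>) ^ 6" for \<xi>
  proof -
    have "f \<xi> * g \<xi> = sqrt (gauss (1 / R) \<xi>) * sqrt (gauss (1 / R) \<xi>) * (norm (?F \<xi>) ^ 2 * norm (?F \<xi>) ^ 3)"
      by (simp add: f_def g_def mult_ac)
    thus "f \<xi> * g \<xi> = gauss (1 / R) \<xi> * norm (?F \<xi>) ^ 5" by (simp only: sq power_add[symmetric]) simp
    show "(f \<xi>)\<^sup>2 = gauss (1 / R) \<xi> * norm (?F \<xi>) ^ 4" "(g \<xi>)\<^sup>2 = gauss (1 / R) \<xi> * norm (?F \<xi>) ^ 6"
      by (auto simp: f_def g_def power_mult_distrib gauss_pos less_imp_le simp flip: power_mult)
  qed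
  have "ennreal ((moment 5 R)\<^sup>2) = (ennreal (moment 5 R))\<^sup>2" by (simp add: ennreal_power moment_nonneg)
  also have "\<dots> = (\<integral>\<^sup>+\<xi>. ennreal (f \<xi>) * ennreal (g \<xi>) \<partial>lborel)\<^sup>2"
    unfolding conv[symmetric] by (simp add: ennreal_mult[symmetric] nn e)
  also have "\<dots> \<le> (\<integral>\<^sup>+\<xi>. (ennreal (f \<xi>))\<^sup>2 \<partial>lborel) * (\<integral>\<^sup>+\<xi>. (ennreal (g \<xi>))\<^sup>2 \<partial>lborel)"
    by (rule Cauchy_Schwarz_nn_integral) auto
  also have "\<dots> = ennreal (moment 4 R) * ennreal (moment 6 R)"
    unfolding conv[symmetric] by (simp add: ennreal_power nn e)
  also have "\<dots> = ennreal (moment 4 R * moment 6 R)" by (simp add: ennreal_mult moment_nonneg)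
  finally have "(moment 5 R)\<^sup>2 \<le> moment 4 R * moment 6 R" by (subst (asm) ennreal_le_iff) (auto simp: moment_nonneg)
  thus ?thesis by (simp add: real_le_rsqrt real_sqrt_mult[symmetric])
qed

lemma mixed_moment_le:
  "mixed_moment (2 ^ n) \<le> (\<Sum>k\<le>n. sqrt 2 * exp pi * (2 ^ k) powr (- 1 / 2) * moment 5 (2 ^ k))"
proof -
  let ?F = "fourier_measure \<sigma>"
  let ?c = "\<lambda>k. sqrt 2 * exp pi * (2 ^ k) powr (- 1 / 2)"
  have i: "integrable lborel (\<lambda>\<xi>. ?c k * (gauss (1 / 2 ^ k) \<xi> * norm (?F \<xi>) ^ 5))" for k
    by (intro integrable_mult_right integrable_moment) auto
  have "mixed_moment (2 ^ n) \<le> (\<integral>\<xi>. (\<Sum>k\<le>n. ?c k * (gauss (1 / 2 ^ k) \<xi> * norm (?F \<xi>) ^ 5)) \<partial>lborel)"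
    unfolding mixed_moment_def
  proof (rule integral_mono)
    fix \<xi>
    have "gauss (1 / 2 ^ n) \<xi> / sqrt (max 1 (norm \<xi>)) * norm (?F \<xi>) ^ 5 \<le> (\<Sum>k\<le>n. ?c k * gauss (1 / 2 ^ k) \<xi>) * norm (?F \<xi>) ^ 5"
      by (intro mult_right_mono gaussian_weight_le_dyadic_sum) auto
    thus "gauss (1 / 2 ^ n) \<xi> * norm (?F \<xi>) ^ 5 * (1 / sqrt (max 1 (norm \<xi>))) \<le> (\<Sum>k\<le>n. ?c k * (gauss (1 / 2 ^ k) \<xi> * norm (?F \<xi>) ^ 5))"
      by (simp add: sum_distrib_right mult.assoc)
  qed (use integrable_mixed i in auto)
  also have "\<dots> = (\<Sum>k\<le>n. \<integral>\<xi>. ?c k * (gauss (1 / 2 ^ k) \<xi> * norm (?F \<xi>) ^ 5) \<partial>lborel)"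
    using i by (intro Bochner_Integration.integral_sum)
  also have "\<dots> = (\<Sum>k\<le>n. ?c k * moment 5 (2 ^ k))" unfolding moment_def by simp
  finally show ?thesis .
qed

text \<open>Put \<open>f k\<close> for the sixth moment at scale \<open>2\<^sup>k\<close> divided by \<open>2\<^sup>k\<^sup>(\<^sup>1\<^sup>-\<^sup>s\<^sup>)\<close>. The \<open>k\<close>-th dyadic piece of
  the mixed moment carries the power of \<open>2\<^sup>k\<close> with exponent
  \<open>- 1/2 + (1 - s) + (1 - s)/2 = 1 - 3 s / 2\<close>, coming from the decay, the fourth moment and the sixth
  moment. Here \<open>s \<ge> 2/3\<close> enters: the exponent is not positive, so that \<open>f n\<close> is bounded by a sum of
  square roots of earlier values with polynomial weights.\<close>
lemma moment_6_le:
  "moment 6 (2 ^ n) \<le> (4 * sqrt 2 * (exp pi)\<^sup>2 * K * D)\<^sup>2 * (48 * K ^ 4 / lam) * (real n + 1) ^ 5 * (2 ^ n) powr (1 - s)"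
proof -
  define f where "f k = moment 6 (2 ^ k) / (2 ^ k) powr (1 - s)" for k :: nat
  define B where "B = 48 * K ^ 4 / lam"
  define A where "A = 4 * sqrt 2 * (exp pi)\<^sup>2 * K * D"
  have K0: "K > 0" using K_ge_2 by simp
  have f0: "f k \<ge> 0" for k by (simp add: f_def moment_nonneg)
  have A0: "A \<ge> 0" and B0: "B \<ge> 0" using K0 D_pos lam_pos by (auto simp: A_def B_def)
  have mf: "moment 6 (2 ^ k) = f k * (2 ^ k) powr (1 - s)" for k by (simp add: f_def)
  have rec: "f n \<le> A * (\<Sum>k\<le>n. sqrt (B * (real k + 1) ^ 3) * sqrt (f k))" for n
  proof -
    have k: "(2 ^ k) powr (- 1 / 2) * moment 5 (2 ^ k) \<le> sqrt (B * (real k + 1) ^ 3) * sqrt (f k)" for k :: nat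
    proof -
      define x :: real where "x = 2 ^ k"
      have x: "x \<ge> 1" by (simp add: x_def)
      have "moment 5 x \<le> sqrt (moment 4 x) * sqrt (moment 6 x)" using x by (intro moment_5_le) simp
      also have "\<dots> \<le> sqrt (B * (real k + 1) ^ 3 * x powr (2 - 2 * s)) * sqrt (f k * x powr (1 - s))"
        unfolding x_def mf
        by (intro mult_mono real_sqrt_le_mono moment_4_le[folded B_def] order_refl) (auto simp: f0 B0)
      also have "\<dots> = sqrt (B * (real k + 1) ^ 3) * sqrt (f k) * (sqrt (x powr (2 - 2 * s)) * sqrt (x powr (1 - s)))"
        by (simp add: real_sqrt_mult)
      also have "sqrt (x powr (2 - 2 * s)) * sqrt (x powr (1 - s)) = x powr ((2 - 2 * s) / 2 + (1 - s) / 2)"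
        using x by (simp add: powr_half_sqrt[symmetric] powr_powr powr_add)
      finally have "x powr (- 1 / 2) * moment 5 x \<le> x powr (- 1 / 2) * (sqrt (B * (real k + 1) ^ 3) * sqrt (f k) * x powr ((2 - 2 * s) / 2 + (1 - s) / 2))"
        by (intro mult_left_mono) auto
      also have "\<dots> = sqrt (B * (real k + 1) ^ 3) * sqrt (f k) * (x powr (- 1 / 2) * x powr ((2 - 2 * s) / 2 + (1 - s) / 2))"
        by (simp only: mult_ac)
      also have "x powr (- 1 / 2) * x powr ((2 - 2 * s) / 2 + (1 - s) / 2) = x powr (1 - 3 * s / 2)"
        unfolding powr_add[symmetric] by (rule arg_cong[where f = "\<lambda>t. x powr t"]) (simp add: field_simps)
      also have "\<dots> \<le> x powr 0" using x s_ge by (intro powr_mono) auto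
      finally show ?thesis using x f0 B0 by (simp add: x_def mult_left_mono)
    qed
    have "f n \<le> 4 * exp pi * K * D * mixed_moment (2 ^ n)"
      using moment_6_le_mixed[of "2 ^ n"] unfolding f_def by (simp add: divide_le_eq mult_ac)
    also have "\<dots> \<le> 4 * exp pi * K * D * (\<Sum>k\<le>n. sqrt 2 * exp pi * (2 ^ k) powr (- 1 / 2) * moment 5 (2 ^ k))"
      using K0 D_pos by (intro mult_left_mono mixed_moment_le) auto
    also have "\<dots> = A * (\<Sum>k\<le>n. (2 ^ k) powr (- 1 / 2) * moment 5 (2 ^ k))"
      by (simp add: A_def sum_distrib_left power2_eq_square mult_ac)
    also have "\<dots> \<le> A * (\<Sum>k\<le>n. sqrt (B * (real k + 1) ^ 3) * sqrt (f k))"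
      using A0 by (intro mult_left_mono sum_mono k)
    finally show ?thesis .
  qed
  have "f n \<le> A\<^sup>2 * B * (real n + 1) ^ 5" by (rule sqrt_recursion_bound[OF f0 A0 B0 rec])
  hence "f n * (2 ^ n) powr (1 - s) \<le> A\<^sup>2 * B * (real n + 1) ^ 5 * (2 ^ n) powr (1 - s)"
    by (intro mult_right_mono) auto
  thus ?thesis unfolding mf[symmetric] A_def B_def .
qed

text \<open>The constant is written in terms of \<open>L\<close>, \<open>lam\<close>, \<open>D\<close> and \<open>\<epsilon>\<close> to show that it serves all
  measures \<open>\<sigma>\<close> at once. The ball is enlarged to the next dyadic radius, at most \<open>2 R\<close>.\<close>
lemma sixth_power_integral_le:
  assumes R: "R \<ge> 1" and \<epsilon>: "0 < \<epsilon>" "\<epsilon> < 1"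
  shows "(\<integral>\<^sup>+\<xi>\<in>ball 0 R. ennreal (norm (fourier_measure \<sigma> \<xi>) ^ 6) \<partial>lborel)
     \<le> ennreal (4 * exp pi * (4 * sqrt 2 * (exp pi)\<^sup>2 * (1 + L) * D)\<^sup>2 * (48 * (1 + L) ^ 4 / lam) * (10 / \<epsilon>) ^ 5 * R powr (1 - s + \<epsilon>))"
proof -
  let ?F = "fourier_measure \<sigma>"
  define Z where "Z = (4 * sqrt 2 * (exp pi)\<^sup>2 * K * D)\<^sup>2 * (48 * K ^ 4 / lam)"
  have Z0: "Z \<ge> 0" using lam_pos K_ge_2 by (simp add: Z_def)
  define n where "n = (LEAST k. R \<le> 2 ^ k)"
  have "\<exists>k. R \<le> 2 ^ k" using real_arch_pow[of 2 R] by (auto intro: less_imp_le)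
  hence n: "R \<le> 2 ^ n" unfolding n_def by (rule LeastI_ex)
  have n2: "2 ^ n \<le> 2 * R"
  proof (cases n)
    case (Suc j)
    hence "\<not> R \<le> 2 ^ j" using not_less_Least[of j "\<lambda>k. R \<le> 2 ^ k"] unfolding n_def by simp
    thus ?thesis by (simp add: Suc)
  qed (use R in simp)
  have "(\<integral>\<^sup>+\<xi>\<in>ball 0 R. ennreal (norm (?F \<xi>) ^ 6) \<partial>lborel) \<le> (\<integral>\<^sup>+\<xi>. ennreal (exp pi * (gauss (1 / 2 ^ n) \<xi> * norm (?F \<xi>) ^ 6)) \<partial>lborel)"
  proof (rule nn_integral_mono)
    fix \<xi> :: "real \<times> real"
    show "ennreal (norm (?F \<xi>) ^ 6) * indicator (ball 0 R) \<xi> \<le> ennreal (exp pi * (gauss (1 / 2 ^ n) \<xi> * norm (?F \<xi>) ^ 6))"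
    proof (cases "\<xi> \<in> ball 0 R")
      case True
      hence "(1 / 2 ^ n * norm \<xi>)\<^sup>2 \<le> 1" using n by (intro power_le_one) auto
      hence "exp pi * exp (- pi) \<le> exp pi * gauss (1 / 2 ^ n) \<xi>" by (simp add: gauss_def)
      hence "1 * norm (?F \<xi>) ^ 6 \<le> exp pi * gauss (1 / 2 ^ n) \<xi> * norm (?F \<xi>) ^ 6"
        by (intro mult_right_mono) (auto simp: exp_minus)
      thus ?thesis using True by (simp add: ennreal_leI mult.assoc)
    qed simp
  qed
  also have "\<dots> = ennreal (exp pi * moment 6 (2 ^ n))"
    unfolding moment_def using integrable_moment[of "2 ^ n" 6]
    by (subst nn_integral_eq_integral) (auto simp: gauss_pos less_imp_le)
  also have "\<dots> \<le> ennreal (4 * exp pi * Z * (10 / \<epsilon>) ^ 5 * R powr (1 - s + \<epsilon>))"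
  proof (rule ennreal_leI)
    have "moment 6 (2 ^ n) \<le> Z * (real n + 1) ^ 5 * (2 ^ n) powr (1 - s)"
      unfolding Z_def by (rule moment_6_le)
    also have "\<dots> \<le> Z * ((10 / \<epsilon>) ^ 5 * (2 ^ n) powr \<epsilon>) * (2 ^ n) powr (1 - s)"
      using Z0 by (intro mult_right_mono mult_left_mono polynomial_le_exponential \<epsilon>) auto
    also have "\<dots> = Z * (10 / \<epsilon>) ^ 5 * (2 ^ n) powr (1 - s + \<epsilon>)"
      by (simp add: powr_add mult_ac)
    also have "(2 ^ n) powr (1 - s + \<epsilon>) \<le> (2 * R) powr (1 - s + \<epsilon>)"
      using n2 s_le \<epsilon> by (intro powr_mono2) auto
    also have "(2 * R) powr (1 - s + \<epsilon>) = 2 powr (1 - s + \<epsilon>) * R powr (1 - s + \<epsilon>)"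
      using R by (simp add: powr_mult)
    also have "2 powr (1 - s + \<epsilon>) \<le> 2 powr 2" using s_ge \<epsilon> by (intro powr_mono) auto
    finally have "moment 6 (2 ^ n) \<le> Z * (10 / \<epsilon>) ^ 5 * (4 * R powr (1 - s + \<epsilon>))"
      using Z0 \<epsilon> by (simp add: mult_left_mono mult_right_mono)
    hence "exp pi * moment 6 (2 ^ n) \<le> exp pi * (Z * (10 / \<epsilon>) ^ 5 * (4 * R powr (1 - s + \<epsilon>)))"
      by (intro mult_left_mono) auto
    thus "exp pi * moment 6 (2 ^ n) \<le> 4 * exp pi * Z * (10 / \<epsilon>) ^ 5 * R powr (1 - s + \<epsilon>)"
      by (simp only: mult_ac)
  qed
  finally show ?thesis by (simp only: Z_def K_def mult.assoc)
qed

end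

theorem theorem1p15:
  fixes \<psi> :: "real \<Rightarrow> real" and s \<epsilon> :: real
  assumes "C2 \<psi>"
    and "\<And>x. deriv (deriv \<psi>) x > 0"
    and "s \<in> {2/3..1}"
    and "\<epsilon> \<in> {0<..<1}"
  shows "\<exists>C::real. C > 0 \<and>
    (\<forall>\<sigma> :: (real \<times> real) measure. frostman s \<sigma> \<and> measure_support \<sigma> \<subseteq> curve \<psi> \<longrightarrow>
      (\<forall>R\<ge>1. (\<integral>\<^sup>+\<xi>\<in>ball 0 R. ennreal (norm (fourier_measure \<sigma> \<xi>) ^ 6) \<partial>lborel)
                \<le> ennreal (C * R powr (1 - s + \<epsilon>))))"
proof -
  let ?\<psi>1 = "deriv \<psi>" and ?\<psi>2 = "deriv (deriv \<psi>)"
  have d: "(\<psi> has_real_derivative ?\<psi>1 x) (at x)" "(?\<psi>1 has_real_derivative ?\<psi>2 x) (at x)" for x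
    using assms(1) unfolding C2_def
    by (auto simp: differentiable_on_def DERIV_deriv_iff_real_differentiable)
  have c1: "continuous_on {-3..3} ?\<psi>1" by (meson continuous_at_imp_continuous_on DERIV_isCont d(2))
  have c2: "continuous_on UNIV ?\<psi>2" using assms(1) by (simp add: C2_def)
  have "bounded (?\<psi>1 ` {-3..3})" by (intro compact_imp_bounded compact_continuous_image c1 compact_Icc)
  then obtain L0 where L0: "\<forall>x\<in>{-3..3}. norm (?\<psi>1 x) \<le> L0" by (auto simp: bounded_iff)
  define L where "L = max 1 L0"
  obtain m where m: "m \<in> {-3..3}" "\<And>x. x \<in> {-3..3} \<Longrightarrow> ?\<psi>2 m \<le> ?\<psi>2 x"
    using continuous_attains_inf[of "{-3..3::real}" ?\<psi>2] continuous_on_subset[OF c2] by auto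
  define lam where "lam = min 1 (?\<psi>2 m)"
  interpret convex_graph \<psi> ?\<psi>1 ?\<psi>2 L lam
  proof
    show "\<bar>?\<psi>1 x\<bar> \<le> L" if "\<bar>x\<bar> \<le> 3" for x using bspec[OF L0, of x] that by (auto simp: L_def abs_le_iff)
    show "lam \<le> ?\<psi>2 x" if "\<bar>x\<bar> \<le> 3" for x using m(2)[of x] that by (auto simp: lam_def abs_le_iff)
  qed (use d c2 assms(2) in \<open>auto simp: L_def lam_def\<close>)
  obtain D where D: "D > 0" "\<And>\<xi>. norm (fourier_measure (graph_measure \<psi>) \<xi>) \<le> D / sqrt (max 1 (norm \<xi>))"
    using fourier_graph_decay by blast
  define C where "C = 4 * exp pi * (4 * sqrt 2 * (exp pi)\<^sup>2 * (1 + L) * D)\<^sup>2 * (48 * (1 + L) ^ 4 / lam) * (10 / \<epsilon>) ^ 5"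
  have "C > 0" unfolding C_def using D(1) L_ge_1 lam_pos assms(4)
    by (intro mult_pos_pos divide_pos_pos zero_less_power) auto
  moreover have "(\<integral>\<^sup>+\<xi>\<in>ball 0 R. ennreal (norm (fourier_measure \<sigma> \<xi>) ^ 6) \<partial>lborel) \<le> ennreal (C * R powr (1 - s + \<epsilon>))"
    if \<sigma>: "frostman s \<sigma>" "measure_support \<sigma> \<subseteq> curve \<psi>" and R: "R \<ge> 1" for \<sigma> R
  proof -
    interpret frostman_on_graph \<psi> ?\<psi>1 ?\<psi>2 L lam s D \<sigma>
      by unfold_locales (use \<sigma> D assms(3) in auto)
    show ?thesis unfolding C_def using sixth_power_integral_le[OF R, of \<epsilon>] assms(4) by simp
  qed
  ultimately show ?thesis by blast
qed

end
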